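(* Let $m,n\ge1$ and let $(\eta,\Delta)$ be any set of constraint edges on $\Lambda^0_{m,n}$. Then the ground state triangulation in $\Omega(\eta,\Delta)$ is unique up to possible flipping of unit diagonals (that is, any two ground state triangulations differ only at midpoints where both have unit diagonals), and it can be constructed by placing, for each midpoint $x\in\Lambda_{m,n}$ independently of the other edges, the edge at $x$ in its minimal length configuration consistent with the constraints.
   Context: $\Lambda^0_{m,n}=\{0,1,\dots,m\}\times\{0,1,\dots,n\}\subset\mathbb{Z}^2$. An edge is a straight segment joining two points of $\Lambda^0_{m,n}$ and passing through no other integer point. Two edges cross if they are distinct and meet at a point that is not a common endpoint. A (full) triangulation of $\Lambda^0_{m,n}$ is a maximal set of pairwise noncrossing edges. In every triangulation the set of midpoints of the edges is exactly $\Lambda_{m,n}=\bigl(\{0,\frac12,1,\dots,m\}\times\{0,\frac12,1,\dots,n\}\bigr)\setminus\Lambda^0_{m,n}$, each midpoint occurring once; so a triangulation is written $\sigma=\{\sigma_x\}_{x\in\Lambda_{m,n}}$, where $\sigma_x$ is the edge with midpoint $x$. A set of constraints $(\eta,\Delta)$ is a subset $\Delta\subseteq\Lambda_{m,n}$ together with pairwise noncrossing edges $\eta=\{\eta_x\}_{x\in\Delta}$, $\eta_x$ having midpoint $x$; these are the constraint edges. $\Omega(\eta,\Delta)$ is the (nonempty) set of triangulations $\sigma$ with $\sigma_x=\eta_x$ for all $x\in\Delta$. A configuration of the edge at $x$ is an edge with midpoint $x$; it is consistent with the constraints if it crosses no constraint edge (so if $x\in\Delta$ the only consistent one is $\eta_x$).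 Lengths are $\ell_1$ lengths; $|\sigma|=\sum_x|\sigma_x|$. A ground state triangulation is an element of $\Omega(\eta,\Delta)$ of minimum total length $|\sigma|$. A unit diagonal is a diagonal of a unit lattice square; flipping it means replacing it by the other diagonal of the same square. *)

theory Defs
  imports "HOL-Analysis.Analysis" "HOL-Library.Uprod"
begin

type_synonym point = "real \<times> real"

text \<open>A straight segment is represented by the unordered pair of its endpoints;
  \<open>segment\<close> is the underlying point set.\<close>

type_synonym edge = "point uprod"

definition lattice :: "nat \<Rightarrow> nat \<Rightarrow> point set" where
  "lattice m n = {(real i, real j) | i j. i \<le> m \<and> j \<le> n}"

definition midpoints :: "nat \<Rightarrow> nat \<Rightarrow> point set" where
  "midpoints m n = {(real i / 2, real j / 2) | i j. i \<le> 2 * m \<and> j \<le> 2 * n} - lattice m n"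

definition segment :: "edge \<Rightarrow> point set" where
  "segment e = convex hull (set_uprod e)"

lemma segment_Upair [simp]: "segment (Upair a b) = closed_segment a b"
  by (simp add: segment_def segment_convex_hull)

lift_definition mid :: "edge \<Rightarrow> point" is "\<lambda>(a, b). midpoint a b"
  by (auto simp: midpoint_sym)

lift_definition len :: "edge \<Rightarrow> real" is
  "\<lambda>(a, b). \<bar>fst a - fst b\<bar> + \<bar>snd a - snd b\<bar>"
  by (auto simp: abs_minus_commute)

lemma mid_Upair [simp]: "mid (Upair a b) = midpoint a b"
  by transfer simp

lemma len_Upair [simp]: "len (Upair a b) = \<bar>fst a - fst b\<bar> + \<bar>snd a - snd b\<bar>"
  by transfer simp

definition edges :: "nat \<Rightarrow> nat \<Rightarrow> edge set" where
  "edges m n = {Upair a b | a b. a \<in> lattice m n \<and> b \<in> lattice m n \<and> a \<noteq> b \<and>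
     closed_segment a b \<inter> (\<int> \<times> \<int>) = {a, b}}"

definition crosses :: "edge \<Rightarrow> edge \<Rightarrow> bool" where
  "crosses e f \<longleftrightarrow>
     e \<noteq> f \<and> (\<exists>p \<in> segment e \<inter> segment f. p \<notin> set_uprod e \<inter> set_uprod f)"

definition noncrossing :: "edge set \<Rightarrow> bool" where
  "noncrossing E \<longleftrightarrow> pairwise (\<lambda>e f. \<not> crosses e f) E"

definition triangulation :: "nat \<Rightarrow> nat \<Rightarrow> edge set \<Rightarrow> bool" where
  "triangulation m n \<sigma> \<longleftrightarrow> \<sigma> \<subseteq> edges m n \<and> noncrossing \<sigma> \<and>
     (\<forall>E. E \<subseteq> edges m n \<and> noncrossing E \<and> \<sigma> \<subseteq> E \<longrightarrow> E = \<sigma>)"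

text \<open>The edge \<open>\<sigma>\<^sub>x\<close>: a triangulation contains exactly one edge with midpoint \<open>x\<close> for every
  \<open>x \<in> midpoints m n\<close>, so the description determines it.\<close>

definition edge_at :: "edge set \<Rightarrow> point \<Rightarrow> edge" where
  "edge_at \<sigma> x = (THE e. e \<in> \<sigma> \<and> mid e = x)"

definition total_len :: "nat \<Rightarrow> nat \<Rightarrow> edge set \<Rightarrow> real" where
  "total_len m n \<sigma> = (\<Sum>x \<in> midpoints m n. len (edge_at \<sigma> x))"

text \<open>Only the values of \<open>\<eta>\<close> on \<open>\<Delta>\<close> matter.\<close>

definition constraints :: "nat \<Rightarrow> nat \<Rightarrow> (point \<Rightarrow> edge) \<Rightarrow> point set \<Rightarrow> bool" where
  "constraints m n \<eta> \<Delta> \<longleftrightarrow> \<Delta> \<subseteq> midpoints m n \<and>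
     (\<forall>x\<in>\<Delta>. \<eta> x \<in> edges m n \<and> mid (\<eta> x) = x) \<and> noncrossing (\<eta> ` \<Delta>)"

definition \<Omega> :: "nat \<Rightarrow> nat \<Rightarrow> (point \<Rightarrow> edge) \<Rightarrow> point set \<Rightarrow> edge set set" where
  "\<Omega> m n \<eta> \<Delta> = {\<sigma>. triangulation m n \<sigma> \<and> (\<forall>x\<in>\<Delta>. edge_at \<sigma> x = \<eta> x)}"

definition ground_state ::
    "nat \<Rightarrow> nat \<Rightarrow> (point \<Rightarrow> edge) \<Rightarrow> point set \<Rightarrow> edge set \<Rightarrow> bool" where
  "ground_state m n \<eta> \<Delta> \<sigma> \<longleftrightarrow> is_arg_min (total_len m n) (\<lambda>\<tau>. \<tau> \<in> \<Omega> m n \<eta> \<Delta>) \<sigma>"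

definition consistent_configuration ::
    "nat \<Rightarrow> nat \<Rightarrow> (point \<Rightarrow> edge) \<Rightarrow> point set \<Rightarrow> point \<Rightarrow> edge \<Rightarrow> bool" where
  "consistent_configuration m n \<eta> \<Delta> x e \<longleftrightarrow>
     e \<in> edges m n \<and> mid e = x \<and> (\<forall>y\<in>\<Delta>. \<not> crosses e (\<eta> y))"

definition minimal_configuration ::
    "nat \<Rightarrow> nat \<Rightarrow> (point \<Rightarrow> edge) \<Rightarrow> point set \<Rightarrow> point \<Rightarrow> edge \<Rightarrow> bool" where
  "minimal_configuration m n \<eta> \<Delta> x e \<longleftrightarrow>
     is_arg_min len (consistent_configuration m n \<eta> \<Delta> x) e"

definition unit_diagonal :: "edge \<Rightarrow> bool" where
  "unit_diagonal e \<longleftrightarrow> (\<exists>i j :: int.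
     e = Upair (of_int i, of_int j) (of_int i + 1, of_int j + 1) \<or>
     e = Upair (of_int i + 1, of_int j) (of_int i, of_int j + 1))"

end

theory Submission
  imports Defs
begin

text \<open>
  An edge \<open>e\<close> of vector \<open>w1 + w2\<close> with \<open>det w1 w2 = 1\<close> is a
  diagonal of a parallelogram without further lattice points, and the other diagonal has the same
  midpoint; replacing one by the other is a flip. The proof rests on one observation about flips.
  Suppose that an edge \<open>f\<close> crosses \<open>e\<close> and that its direction is outside
  the open cone spanned by \<open>w1\<close> and \<open>w2\<close>. Then any edge that crosses the
  flipped edge also crosses \<open>e\<close> or \<open>f\<close>. In the coordinates given by
  \<open>w1\<close> and \<open>w2\<close>, \<open>e\<close> is the diagonal of the unit square and
  \<open>f\<close> runs from the quadrant beyond the corner \<open>(0, 1)\<close> to that beyond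
  \<open>(1, 0)\<close>. An edge crossing the antidiagonal either does the same, and then crosses
  \<open>e\<close>, or it runs from the quadrant beyond \<open>(0, 0)\<close> to that beyond
  \<open>(1, 1)\<close>, and then it cannot avoid \<open>f\<close>, because all endpoints are
  lattice points (\<open>antidiagonal_crossed\<close>, \<open>flip\<close>). Consequently, if
  constraint edges cross neither \<open>e\<close> nor \<open>f\<close>, they do not cross the
  flipped edge either. Two choices of the splitting exploit this.

  For lengths, let \<open>e\<close> have length at least 3 and split it within a closed quadrant
  (\<open>l1_split\<close>), which makes the flipped edge shorter. An edge \<open>f\<close> that
  crosses \<open>e\<close> and is not longer cannot have its direction in the cone. So if two
  consistent edges cross, the longer one has a shorter consistent configuration, unless both have
  length at most 2 and are the two diagonals of one unit square
  (\<open>crossing_minimal_configurations\<close>). Thus minimal configurations at different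
  midpoints never cross, and two different ones at the same midpoint, which do cross, are unit
  diagonals.

  For existence, let \<open>h\<close> be an edge crossing \<open>e\<close> and choose a splitting
  of \<open>e\<close> whose summands have positive determinant with \<open>h\<close>
  (\<open>unimodular_split\<close>). Now \<open>h\<close> itself plays the role of
  \<open>f\<close>, and the flip decreases the determinant with \<open>h\<close>. Inserting
  noncrossing edges one by one, this shows that every midpoint has an edge crossing none of them
  (\<open>exists_edge_at_crossing_none\<close>). It follows that a triangulation has an edge at
  every midpoint and that consistent configurations exist.

  Hence the minimal configurations, chosen independently, form a triangulation satisfying the
  constraints. Every edge of any such triangulation is consistent, so its total length is at least
  the sum of the minima, with equality exactly for triangulations made of minimal configurations.
\<close>

section \<open>Lattice segments and proper crossings\<close>

type_synonym ipoint = "int \<times> int"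

definition det2 :: "ipoint \<Rightarrow> ipoint \<Rightarrow> int" where
  "det2 u v = fst u * snd v - snd u * fst v"

definition orient :: "ipoint \<Rightarrow> ipoint \<Rightarrow> ipoint \<Rightarrow> int" where
  "orient a b c = det2 (b - a) (c - a)"

text \<open>Two lattice segments cross at a point interior to both exactly when the endpoints of
  each lie strictly on opposite sides of the line through the other. Products of orientations make
  this a polynomial condition over the integers, and the geometric part of the proof works with
  it.\<close>

definition proper_cross :: "ipoint \<Rightarrow> ipoint \<Rightarrow> ipoint \<Rightarrow> ipoint \<Rightarrow> bool" where
  "proper_cross a b c d \<longleftrightarrow>
     orient a b c * orient a b d < 0 \<and> orient c d a * orient c d b < 0"

definition primitive :: "ipoint \<Rightarrow> bool" where
  "primitive u \<longleftrightarrow> coprime (fst u) (snd u)"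

lemma det2_add_right: "det2 u (v + w) = det2 u v + det2 u w"
  by (simp add: det2_def algebra_simps)

lemma det2_diff_right: "det2 u (v - w) = det2 u v - det2 u w"
  by (simp add: det2_def algebra_simps)

lemma primitive_uminus [simp]: "primitive (- u) = primitive u"
  by (simp add: primitive_def)

lemma orient_swap: "orient b a c = - orient a b c"
  by (simp add: orient_def det2_def algebra_simps)

lemma proper_cross_swap1: "proper_cross b a c d = proper_cross a b c d"
  by (simp add: proper_cross_def orient_swap[of b a] mult.commute)

lemma proper_cross_swap2: "proper_cross a b d c = proper_cross a b c d"
  by (simp add: proper_cross_def orient_swap[of d c] mult.commute)

text \<open>A common divisor of the two entries of \<open>u\<close> divides every determinant with
  \<open>u\<close>.\<close>

lemma primitive_det1: assumes "det2 u v = 1" shows "primitive u"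
proof -
  have "fst u * snd v - snd u * fst v = 1" using assms by (simp add: det2_def)
  then have "gcd (fst u) (snd u) dvd 1"
    by (metis dvd_diff gcd_dvd1 gcd_dvd2 dvd_mult2)
  then show ?thesis by (simp add: primitive_def coprime_iff_gcd_eq_1)
qed

section \<open>Segments across the unit square\<close>

text \<open>A segment crossing the diagonal of the unit square in a non-increasing direction
  leaves the square on both sides. Its endpoints are lattice points, so they lie in the quadrants
  whose apexes are the two other corners \<open>(1, 0)\<close> and \<open>(0, 1)\<close>: the line
  meets the diagonal strictly between \<open>(0, 0)\<close> and \<open>(1, 1)\<close>, which
  bounds a weighted mean of the coordinates of each endpoint strictly between 0 and 1.\<close>

lemma diagonal_crossed_off_cone:
  assumes "proper_cross (0, 0) (1, 1) F G"
    and "(fst F - fst G) * (snd F - snd G) \<le> 0"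
  shows "fst F \<ge> 1 \<and> snd F \<le> 0 \<and> fst G \<le> 0 \<and> snd G \<ge> 1 \<or>
         fst G \<ge> 1 \<and> snd G \<le> 0 \<and> fst F \<le> 0 \<and> snd F \<ge> 1"
proof -
  have *: "fst F \<ge> 1 \<and> snd F \<le> 0 \<and> fst G \<le> 0 \<and> snd G \<ge> 1"
    if pc: "proper_cross (0, 0) (1, 1) F G"
      and nc: "(fst F - fst G) * (snd F - snd G) \<le> 0"
      and side: "snd F < fst F" for F G :: ipoint
  proof -
    obtain F1 F2 G1 G2 where FG: "F = (F1, F2)" "G = (G1, G2)" by fastforce
    \<comment> \<open>The weights of the mean: the line through the two points is the set of
      \<open>(x, y)\<close> with constant \<open>p * y + q * x\<close>.\<close>
    define p q where "p = F1 - G1" and "q = G2 - F2"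
    have "(F2 - F1) * (G2 - G1) < 0"
      using pc by (simp add: proper_cross_def orient_def det2_def FG)
    then have G: "G1 < G2" using side by (auto simp: FG mult_less_0_iff)
    have pq: "p \<ge> 0" "q \<ge> 0"
      using nc side G unfolding FG p_def q_def fst_conv snd_conv
      by (auto simp: mult_le_0_iff)
    have eq: "p * F2 + q * F1 = p * G2 + q * G1"
      unfolding p_def q_def by (simp add: algebra_simps)
    have "(p * F2 + q * F1) * (p * F2 + q * F1 - (p + q)) < 0"
      using pc unfolding proper_cross_def orient_def det2_def FG p_def q_def
      by (simp add: algebra_simps)
    then have K: "0 < p * F2 + q * F1" "p * F2 + q * F1 < p + q"
      using pq by (auto simp: mult_less_0_iff)
    have side': "F2 < F1" using side FG by simp
    have "F2 \<le> 0"
    proof (rule ccontr)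
      assume "\<not> F2 \<le> 0"
      then have "p * 1 \<le> p * F2" "q * 1 \<le> q * F1"
        using pq side' by (intro mult_left_mono; linarith)+
      then show False using K by simp
    qed
    moreover have "F1 \<ge> 1"
    proof (rule ccontr)
      assume "\<not> F1 \<ge> 1"
      then have "p * F2 \<le> 0" "q * F1 \<le> 0"
        using pq side' by (intro mult_nonneg_nonpos; linarith)+
      then show False using K by simp
    qed
    moreover have "G1 \<le> 0"
    proof (rule ccontr)
      assume "\<not> G1 \<le> 0"
      then have "p * 1 \<le> p * G2" "q * 1 \<le> q * G1"
        using pq G by (intro mult_left_mono; linarith)+
      then show False using K eq by simp
    qed
    moreover have "G2 \<ge> 1"
    proof (rule ccontr)
      assume "\<not> G2 \<ge> 1"
      then have "p * G2 \<le> 0" "q * G1 \<le> 0"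
        using pq G by (intro mult_nonneg_nonpos; linarith)+
      then show False using K eq by simp
    qed
    ultimately show ?thesis by (simp add: FG)
  qed
  show ?thesis
  proof (cases "snd F < fst F")
    case True
    then show ?thesis using *[of F G] assms by blast
  next
    case False
    have "(snd F - fst F) * (snd G - fst G) < 0"
      using assms(1) by (simp add: proper_cross_def orient_def det2_def)
    then have "snd G < fst G" using False by (auto simp: mult_less_0_iff)
    moreover have "(fst G - fst F) * (snd G - snd F) \<le> 0"
      using assms(2) by (simp add: algebra_simps)
    ultimately show ?thesis using *[of G F] assms(1) by (simp add: proper_cross_swap2)
  qed
qed

text \<open>Let \<open>A\<close> and \<open>B\<close> be the ends of a segment that crosses the
  antidiagonal, with difference \<open>(p, q)\<close>. If \<open>p\<close> or \<open>q\<close> is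
  nonpositive, the preceding lemma's reasoning forces the ends into the quadrants at \<open>(1,
  0)\<close> and \<open>(0, 1)\<close>, and the segment crosses the diagonal. If both are
  positive, the ends lie in the quadrants at \<open>(0, 0)\<close> and \<open>(1, 1)\<close>,
  while those of the decreasing segment from \<open>F\<close> to \<open>G\<close> lie in the other
  two quadrants; as that segment separates \<open>(0, 0)\<close> from \<open>(1, 1)\<close>, and
  this one separates \<open>(1, 0)\<close> from \<open>(0, 1)\<close>, the two must cross.\<close>

lemma antidiagonal_crossed:
  assumes e': "proper_cross (1, 0) (0, 1) A B"
    and ef: "proper_cross (0, 0) (1, 1) F G"
    and F: "fst F \<ge> 1" "snd F \<le> 0" and G: "fst G \<le> 0" "snd G \<ge> 1"
  shows "proper_cross (0, 0) (1, 1) A B \<or> proper_cross F G A B"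
proof -
  have *: "proper_cross (0, 0) (1, 1) A B \<or> proper_cross F G A B"
    if e': "proper_cross (1, 0) (0, 1) A B" and side: "fst A + snd A < fst B + snd B" for A B
  proof -
    obtain A1 A2 B1 B2 F1 F2 G1 G2
      where pts: "A = (A1, A2)" "B = (B1, B2)" "F = (F1, F2)" "G = (G1, G2)" by fastforce
    define p q where "p = B1 - A1" and "q = B2 - A2"
    define K where "K = q * A1 - p * A2"
    have K': "K = q * B1 - p * B2" by (simp add: K_def p_def q_def algebra_simps)
    have pq: "p + q > 0" using side by (simp add: pts p_def q_def)
    have "(1 - A1 - A2) * (1 - B1 - B2) < 0"
      using e' by (simp add: proper_cross_def orient_def det2_def pts algebra_simps)
    then have AB: "A1 + A2 \<le> 0" "B1 + B2 \<ge> 2"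
      using side by (auto simp: mult_less_0_iff pts)
    have "(K - q) * (K + p) < 0"
      using e' by (simp add: proper_cross_def orient_def det2_def pts K_def p_def q_def algebra_simps)
    then have K: "- p < K" "K < q" using pq by (auto simp: mult_less_0_iff)
    have e_iff: "proper_cross (0, 0) (1, 1) A B \<longleftrightarrow>
        (A2 - A1) * (B2 - B1) < 0 \<and> K * (K + p - q) < 0"
      by (simp add: proper_cross_def orient_def det2_def pts K_def p_def q_def algebra_simps)
    consider "p \<le> 0" | "q \<le> 0" | "p \<ge> 1" "q \<ge> 1" by linarith
    then show ?thesis
    proof cases
      case 1
      have "A1 \<ge> 1"
      proof (rule ccontr)
        assume "\<not> A1 \<ge> 1"
        then have "(q + p) * A1 \<le> 0" "- p * (A2 + A1) \<le> 0"
          using 1 pq AB by (intro mult_nonneg_nonpos; linarith)+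
        then show False using K 1 by (simp add: K_def algebra_simps)
      qed
      moreover have "B1 \<le> 0"
      proof (rule ccontr)
        assume "\<not> B1 \<le> 0"
        then have "(q + p) * 1 \<le> (q + p) * B1" "- p * 2 \<le> - p * (B1 + B2)"
          using 1 pq AB by (intro mult_left_mono; linarith)+
        then show False using K 1 by (simp add: K' algebra_simps)
      qed
      ultimately have "(A2 - A1) * (B2 - B1) < 0" using AB by (simp add: mult_less_0_iff)
      moreover have "K * (K + p - q) < 0" using K 1 by (simp add: mult_less_0_iff)
      ultimately show ?thesis using e_iff by blast
    next
      case 2
      have "A2 \<ge> 1"
      proof (rule ccontr)
        assume "\<not> A2 \<ge> 1"
        then have "(q + p) * A2 \<le> 0" "- q * (A2 + A1) \<le> 0"
          using 2 pq AB by (intro mult_nonneg_nonpos; linarith)+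
        then show False using K 2 by (simp add: K_def algebra_simps)
      qed
      moreover have "B2 \<le> 0"
      proof (rule ccontr)
        assume "\<not> B2 \<le> 0"
        then have "(q + p) * 1 \<le> (q + p) * B2" "- q * 2 \<le> - q * (B1 + B2)"
          using 2 pq AB by (intro mult_left_mono; linarith)+
        then show False using K 2 by (simp add: K' algebra_simps)
      qed
      ultimately have "(A2 - A1) * (B2 - B1) < 0" using AB by (simp add: mult_less_0_iff)
      moreover have "K * (K + p - q) < 0" using K 2 by (simp add: mult_less_0_iff)
      ultimately show ?thesis using e_iff by blast
    next
      case 3
      have mono: "p * x \<le> p * y" "q * x \<le> q * y" if "x \<le> y" for x y
        using 3 that by (auto intro: mult_left_mono)
      have "A1 \<le> 0"
      proof (rule ccontr)
        assume "\<not> A1 \<le> 0"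
        then have "q * 1 \<le> q * A1" "p * A2 \<le> p * (- 1)" using AB by (intro mono; linarith)+
        then show False using K 3 unfolding K_def by linarith
      qed
      moreover have "A2 \<le> 0"
      proof (rule ccontr)
        assume "\<not> A2 \<le> 0"
        then have "p * 1 \<le> p * A2" "q * A1 \<le> q * (- 1)" using AB by (intro mono; linarith)+
        then show False using K 3 unfolding K_def by linarith
      qed
      ultimately have A: "A1 \<le> 0" "A2 \<le> 0" by auto
      have "B1 \<ge> 1"
      proof (rule ccontr)
        assume "\<not> B1 \<ge> 1"
        then have "q * B1 \<le> q * 0" "p * 2 \<le> p * B2" using AB by (intro mono; linarith)+
        then show False using K 3 unfolding K' by linarith
      qed
      moreover have "B2 \<ge> 1"
      proof (rule ccontr)
        assume "\<not> B2 \<ge> 1"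
        then have "p * B2 \<le> p * 0" "q * 2 \<le> q * B1" using AB by (intro mono; linarith)+
        then show False using K 3 unfolding K' by linarith
      qed
      ultimately have B: "B1 \<ge> 1" "B2 \<ge> 1" by auto
      define r s where "r = F1 - G1" and "s = G2 - F2"
      \<comment> \<open>Up to sign the orientation of \<open>(x, y)\<close> with respect to
        \<open>F\<close> and \<open>G\<close>; it increases with both coordinates.\<close>
      define M where "M x y = r * (y - G2) + s * (x - G1)" for x y
      have rs: "r > 0" "s > 0" using F G by (auto simp: r_def s_def pts)
      have Mmono: "M x y \<le> M x' y'" if "x \<le> x'" "y \<le> y'" for x y x' y'
        unfolding M_def using rs that by (intro add_mono mult_left_mono) auto
      have "M 0 0 * M 1 1 < 0"
        using ef by (simp add: proper_cross_def orient_def det2_def pts M_def r_def s_def algebra_simps)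
      then have "M 0 0 < 0" "M 1 1 > 0" using Mmono[of 0 1 0 1] by (auto simp: mult_less_0_iff)
      then have "M A1 A2 * M B1 B2 < 0"
        using Mmono[OF A] Mmono[OF B] by (simp add: mult_less_0_iff)
      then have 1: "orient F G A * orient F G B < 0"
        by (simp add: orient_def det2_def pts M_def r_def s_def algebra_simps)
      have "K + p * F2 - q * F1 < 0"
        using mono[of F2 0] mono[of 1 F1] F K by (simp add: pts)
      moreover have "K + p * G2 - q * G1 > 0"
        using mono[of 1 G2] mono[of G1 0] G K by (simp add: pts)
      ultimately have "(K + p * F2 - q * F1) * (K + p * G2 - q * G1) < 0"
        by (simp add: mult_less_0_iff)
      then have "orient A B F * orient A B G < 0"
        by (simp add: orient_def det2_def pts K_def p_def q_def algebra_simps)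
      with 1 show ?thesis by (simp add: proper_cross_def)
    qed
  qed
  show ?thesis
  proof (cases "fst A + snd A < fst B + snd B")
    case True
    then show ?thesis using * e' by blast
  next
    case False
    have "(1 - fst A - snd A) * (1 - fst B - snd B) < 0"
      using e' by (simp add: proper_cross_def orient_def det2_def algebra_simps)
    then have "fst B + snd B < fst A + snd A" using False by (auto simp: mult_less_0_iff)
    then show ?thesis using *[of B A] e' by (simp add: proper_cross_swap2)
  qed
qed

section \<open>Unimodular parallelograms\<close>

text \<open>The coordinates of \<open>P\<close> with respect to the origin \<open>a\<close> and
  the lattice basis \<open>w1\<close>, \<open>w2\<close>, by Cramer's rule when the basis has
  determinant 1. They carry the parallelogram spanned by the basis at \<open>a\<close> to the unit
  square.\<close>

definition coords :: "ipoint \<Rightarrow> ipoint \<Rightarrow> ipoint \<Rightarrow> ipoint \<Rightarrow> ipoint" where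
  "coords a w1 w2 P = (det2 (P - a) w2, det2 w1 (P - a))"

lemma orient_coords:
  assumes "det2 w1 w2 = 1"
  shows "orient (coords a w1 w2 P) (coords a w1 w2 Q) (coords a w1 w2 R) = orient P Q R"
proof -
  have "orient (coords a w1 w2 P) (coords a w1 w2 Q) (coords a w1 w2 R)
      = det2 w1 w2 * orient P Q R"
    by (simp add: orient_def coords_def det2_def algebra_simps)
  then show ?thesis using assms by simp
qed

lemma proper_cross_coords:
  assumes "det2 w1 w2 = 1"
  shows "proper_cross (coords a w1 w2 P) (coords a w1 w2 Q) (coords a w1 w2 R) (coords a w1 w2 S)
      = proper_cross P Q R S"
  by (simp add: proper_cross_def orient_coords[OF assms])

lemma coords_parallelogram:
  assumes "det2 w1 w2 = 1"
  shows "coords a w1 w2 a = (0, 0)" "coords a w1 w2 (a + w1) = (1, 0)"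
    "coords a w1 w2 (a + w2) = (0, 1)" "coords a w1 w2 (a + w1 + w2) = (1, 1)"
  using assms by (simp_all add: coords_def det2_def algebra_simps)

lemma basis_expansion:
  assumes "det2 w1 w2 = 1"
  shows "fst v = det2 v w2 * fst w1 + det2 w1 v * fst w2"
    "snd v = det2 v w2 * snd w1 + det2 w1 v * snd w2"
proof -
  have "fst v * det2 w1 w2 = det2 v w2 * fst w1 + det2 w1 v * fst w2"
    "snd v * det2 w1 w2 = det2 v w2 * snd w1 + det2 w1 v * snd w2"
    by (simp_all add: det2_def algebra_simps)
  with assms show "fst v = det2 v w2 * fst w1 + det2 w1 v * fst w2"
    "snd v = det2 v w2 * snd w1 + det2 w1 v * snd w2" by simp_all
qed

text \<open>The statement about the unit square, moved to an arbitrary unimodular parallelogram: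
  passing from the diagonal from \<open>a\<close> to \<open>a + w1 + w2\<close> to the other
  diagonal creates no crossing with a segment that crosses neither the old diagonal nor one fixed
  segment from \<open>F\<close> to \<open>G\<close> across it. The cone hypothesis says that
  \<open>F - G\<close> is not a combination of \<open>w1\<close> and \<open>w2\<close> with two
  nonzero coefficients of equal sign.\<close>

lemma flipped_crossing:
  assumes det: "det2 w1 w2 = 1"
    and ef: "proper_cross a (a + w1 + w2) F G"
    and cone: "det2 (F - G) w2 * det2 w1 (F - G) \<le> 0"
    and e': "proper_cross (a + w1) (a + w2) A B"
  shows "proper_cross a (a + w1 + w2) A B \<or> proper_cross F G A B"
proof -
  let ?T = "coords a w1 w2"
  note T = proper_cross_coords[OF det, of a] and P = coords_parallelogram[OF det, of a]
  have ef': "proper_cross (0, 0) (1, 1) (?T F) (?T G)"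
    using ef T[of a "a + w1 + w2" F G] by (simp add: P)
  have e'': "proper_cross (1, 0) (0, 1) (?T A) (?T B)"
    using e' T[of "a + w1" "a + w2" A B] by (simp add: P)
  have "(fst (?T F) - fst (?T G)) * (snd (?T F) - snd (?T G)) \<le> 0"
    using cone by (simp add: coords_def det2_def algebra_simps)
  from diagonal_crossed_off_cone[OF ef' this]
  have "proper_cross (0, 0) (1, 1) (?T A) (?T B) \<or> proper_cross (?T F) (?T G) (?T A) (?T B)"
    using antidiagonal_crossed[OF e'' ef'] antidiagonal_crossed[OF e'', of "?T G" "?T F"] ef'
    by (auto simp: proper_cross_swap1 proper_cross_swap2)
  then show ?thesis
    using T[of a "a + w1 + w2" A B] T[of F G A B] by (simp add: P)
qed

text \<open>A half-plane containing both segments contains the whole parallelogram, since a corner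
  off the diagonal lies in their convex hull. In coordinates: an affine functional that is
  negative at such a corner and nonnegative on the diagonal only decreases on the quadrant at that
  corner, which contains an endpoint of the crossing segment. The four sides of the grid give four
  such half-planes.\<close>

lemma flipped_in_half_plane:
  fixes c1 c2 k :: int
  defines "l \<equiv> \<lambda>P. c1 * fst P + c2 * snd P"
  assumes det: "det2 w1 w2 = 1"
    and ef: "proper_cross a (a + w1 + w2) F G"
    and cone: "det2 (F - G) w2 * det2 w1 (F - G) \<le> 0"
    and in_half: "l a \<ge> k" "l (a + w1 + w2) \<ge> k" "l F \<ge> k" "l G \<ge> k"
  shows "l (a + w1) \<ge> k \<and> l (a + w2) \<ge> k"
proof -
  let ?T = "coords a w1 w2"
  note T = proper_cross_coords[OF det, of a] and P = coords_parallelogram[OF det, of a]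
  have ef': "proper_cross (0, 0) (1, 1) (?T F) (?T G)"
    using ef T[of a "a + w1 + w2" F G] by (simp add: P)
  have "(fst (?T F) - fst (?T G)) * (snd (?T F) - snd (?T G)) \<le> 0"
    using cone by (simp add: coords_def det2_def algebra_simps)
  note FG = diagonal_crossed_off_cone[OF ef' this]
  have l_add: "l (P + Q) = l P + l Q" for P Q by (simp add: l_def algebra_simps)
  have l_T: "l Q = l a + fst (?T Q) * l w1 + snd (?T Q) * l w2" for Q
  proof -
    have "l Q = l a + (c1 * fst (Q - a) + c2 * snd (Q - a))" by (simp add: l_def algebra_simps)
    also have "\<dots> = l a + fst (?T Q) * l w1 + snd (?T Q) * l w2"
      by (subst basis_expansion[OF det, of "Q - a"])+ (simp add: l_def coords_def algebra_simps)
    finally show ?thesis .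
  qed
  have corner: "l a + l w1 \<ge> k \<and> l a + l w2 \<ge> k"
    if x: "x \<ge> 1" "y \<le> 0" "l a + x * l w1 + y * l w2 \<ge> k"
      and x': "x' \<le> 0" "y' \<ge> 1" "l a + x' * l w1 + y' * l w2 \<ge> k" for x y x' y'
  proof (intro conjI; rule ccontr)
    assume c: "\<not> l a + l w1 \<ge> k"
    then have "l w1 \<le> 0" "l w2 \<ge> 0" using in_half(1,2) by (simp_all add: l_add)
    then have "x * l w1 \<le> 1 * l w1" "y * l w2 \<le> 0"
      using x by (auto intro!: mult_right_mono_neg mult_nonpos_nonneg simp del: mult_1)
    then show False using x c by linarith
  next
    assume c: "\<not> l a + l w2 \<ge> k"
    then have "l w2 \<le> 0" "l w1 \<ge> 0" using in_half(1,2) by (simp_all add: l_add)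
    then have "y' * l w2 \<le> 1 * l w2" "x' * l w1 \<le> 0"
      using x' by (auto intro!: mult_right_mono_neg mult_nonpos_nonneg simp del: mult_1)
    then show False using x' c by linarith
  qed
  show ?thesis
    using FG in_half(3,4) corner[of "fst (?T F)" "snd (?T F)" "fst (?T G)" "snd (?T G)"]
      corner[of "fst (?T G)" "snd (?T G)" "fst (?T F)" "snd (?T F)"]
    by (auto simp: l_T[of F] l_T[of G] l_add)
qed

section \<open>Splitting a primitive vector\<close>

text \<open>Bezout's identity gives some \<open>w\<close> with \<open>det2 w e = 1\<close>, and
  adding a multiple of \<open>e\<close> to it keeps this determinant and reduces \<open>det2 h
  w\<close> modulo \<open>det2 h e\<close>. The remainder is nonzero because otherwise
  \<open>h\<close> would be a proper multiple of the adjusted \<open>w\<close>. Flipping the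
  resulting parallelogram replaces the sum of the two positive determinants with \<open>h\<close>
  by their difference.\<close>

lemma unimodular_split:
  assumes e: "primitive e" and h: "primitive h" and "det2 h e \<ge> 2"
  obtains w1 w2 where "e = w1 + w2" "det2 w1 w2 = 1" "det2 h w1 > 0" "det2 h w2 > 0"
proof -
  obtain x y where xy: "x * fst e + y * snd e = 1"
    using e bezout_int[of "fst e" "snd e"] by (auto simp: primitive_def)
  define w where "w = (y, - x)"
  define k where "k = det2 h w div det2 h e"
  define w1 where "w1 = (fst w - k * fst e, snd w - k * snd e)"
  have w1e: "det2 w1 e = 1" using xy by (simp add: w1_def w_def det2_def algebra_simps)
  have hw1: "det2 h w1 = det2 h w mod det2 h e"
    unfolding minus_mult_div_eq_mod[symmetric] k_def[symmetric]
    by (simp add: w1_def det2_def algebra_simps)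
  have "det2 h w1 \<noteq> 0"
  proof
    assume 0: "det2 h w1 = 0"
    have "det2 w1 h = 0" using 0 by (simp add: det2_def algebra_simps)
    then have "fst h = det2 h e * fst w1" "snd h = det2 h e * snd w1"
      using basis_expansion[OF w1e, of h] by simp_all
    then have "det2 h e dvd 1"
      using h unfolding primitive_def coprime_def by (metis dvd_triv_left)
    then show False using assms(3) by simp
  qed
  moreover have "0 \<le> det2 h w1" "det2 h w1 < det2 h e"
    using assms(3) by (simp_all add: hw1)
  ultimately have "det2 h w1 > 0" "det2 h w1 < det2 h e" by linarith+
  then show ?thesis
    using w1e by (intro that[of w1 "e - w1"]) (simp_all add: det2_def algebra_simps)
qed

definition norm1 :: "ipoint \<Rightarrow> int" where
  "norm1 v = \<bar>fst v\<bar> + \<bar>snd v\<bar>"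

text \<open>If the product were negative, \<open>s1 * t2\<close> and \<open>t1 * s2\<close> would
  have strictly opposite signs, which two consecutive integers cannot have.\<close>

lemma opposite_products:
  fixes s1 s2 t1 t2 :: int
  assumes "s1 * t2 - t1 * s2 = 1" "t1 * t2 > 0"
  shows "s1 * s2 \<ge> 0"
proof (rule ccontr)
  assume "\<not> s1 * s2 \<ge> 0"
  then have "(s1 * t2) * (t1 * s2) < 0"
    using assms(2) by (metis mult.commute mult.left_commute mult_less_0_iff not_le)
  moreover have "(s1 * t2) * (t1 * s2) \<ge> 0"
  proof -
    have "s1 * t2 = t1 * s2 + 1" using assms(1) by simp
    moreover have "t1 * s2 + 1 \<le> 0 \<or> t1 * s2 \<ge> 0" by linarith
    ultimately show ?thesis by (auto simp: mult_nonneg_nonneg mult_nonpos_nonpos simp del: zero_le_mult_iff)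
  qed
  ultimately show False by simp
qed

text \<open>The splitting relative to a coordinate axis in which \<open>e\<close> has extent at
  least 2. It places both summands strictly on one side of the axis, and the determinant condition
  then puts them into a common closed quadrant, so the norm is additive on them and the difference
  is shorter than the sum.\<close>

lemma l1_split:
  assumes e: "primitive e" and "norm1 e \<ge> 3"
  obtains w1 w2 where "e = w1 + w2" "det2 w1 w2 = 1"
    "fst w1 * fst w2 \<ge> 0" "snd w1 * snd w2 \<ge> 0" "norm1 (w1 - w2) < norm1 e"
proof -
  consider "\<bar>snd e\<bar> \<ge> 2" | "\<bar>fst e\<bar> \<ge> 2" using assms(2) by (fastforce simp: norm1_def)
  then show ?thesis
  proof cases
    case 1
    define h :: ipoint where "h = (sgn (snd e), 0)"
    have "primitive h" "det2 h e \<ge> 2"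
      using 1 by (auto simp: h_def primitive_def det2_def sgn_if)
    then obtain w1 w2 where w: "e = w1 + w2" "det2 w1 w2 = 1" "det2 h w1 > 0" "det2 h w2 > 0"
      using unimodular_split[OF e] by metis
    then have pos: "snd w1 * snd w2 > 0"
      by (auto simp: h_def det2_def zero_less_mult_iff sgn_if split: if_splits)
    then have nn: "fst w1 * fst w2 \<ge> 0"
      using w(2) by (intro opposite_products[of _ "snd w2" "snd w1"]) (auto simp: det2_def)
    have "norm1 (w1 - w2) < norm1 e"
      using pos nn unfolding norm1_def w(1) zero_less_mult_iff zero_le_mult_iff by auto
    then show ?thesis using that w pos nn by (simp add: less_imp_le)
  next
    case 2
    define h :: ipoint where "h = (0, - sgn (fst e))"
    have "primitive h" "det2 h e \<ge> 2"
      using 2 by (auto simp: h_def primitive_def det2_def sgn_if)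
    then obtain w1 w2 where w: "e = w1 + w2" "det2 w1 w2 = 1" "det2 h w1 > 0" "det2 h w2 > 0"
      using unimodular_split[OF e] by metis
    then have pos: "fst w1 * fst w2 > 0"
      by (auto simp: h_def det2_def zero_less_mult_iff sgn_if split: if_splits)
    then have nn: "snd w2 * snd w1 \<ge> 0"
      using w(2) by (intro opposite_products[of _ "fst w1" "fst w2"]) (auto simp: det2_def mult.commute)
    have "norm1 (w1 - w2) < norm1 e"
      using pos nn unfolding norm1_def w(1) zero_less_mult_iff zero_le_mult_iff by auto
    then show ?thesis using that w pos nn by (simp add: less_imp_le mult.commute)
  qed
qed

text \<open>In a closed quadrant the norm is additive, so a vector in the open cone of
  \<open>w1\<close> and \<open>w2\<close>, which has positive integer coordinates in this basis,
  is at least as long as \<open>w1 + w2\<close>, with equality only when both coordinates are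
  1.\<close>

lemma short_vector_in_cone:
  assumes det: "det2 w1 w2 = 1"
    and quad: "fst w1 * fst w2 \<ge> 0" "snd w1 * snd w2 \<ge> 0"
    and short: "norm1 v \<le> norm1 (w1 + w2)"
    and cone: "det2 v w2 > 0" "det2 w1 v > 0"
  shows "v = w1 + w2"
proof -
  define p q where "p = det2 v w2" and "q = det2 w1 v"
  have pq: "p \<ge> 1" "q \<ge> 1" using cone by (auto simp: p_def q_def)
  have abs_comb: "\<bar>p * x + q * y\<bar> = p * \<bar>x\<bar> + q * \<bar>y\<bar>"
    if "x * y \<ge> 0" "p \<ge> 1" "q \<ge> 1" for p q x y :: int
  proof -
    have "(x \<ge> 0 \<and> y \<ge> 0) \<or> (x \<le> 0 \<and> y \<le> 0)" using that by (simp add: zero_le_mult_iff)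
    then show ?thesis
    proof
      assume "x \<ge> 0 \<and> y \<ge> 0"
      then show ?thesis using that by simp
    next
      assume *: "x \<le> 0 \<and> y \<le> 0"
      then have "p * x \<le> 0" "q * y \<le> 0" using that by (auto simp: mult_le_0_iff)
      then show ?thesis using * by simp
    qed
  qed
  have v: "fst v = p * fst w1 + q * fst w2" "snd v = p * snd w1 + q * snd w2"
    using basis_expansion[OF det, of v] by (simp_all add: p_def q_def)
  have "norm1 v = p * norm1 w1 + q * norm1 w2"
    unfolding norm1_def v using abs_comb[OF quad(1) pq] abs_comb[OF quad(2) pq]
    by (simp add: algebra_simps)
  moreover have "norm1 (w1 + w2) = norm1 w1 + norm1 w2"
    using abs_comb[OF quad(1), of 1 1] abs_comb[OF quad(2), of 1 1] by (simp add: norm1_def)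
  moreover have "norm1 w1 \<noteq> 0" "norm1 w2 \<noteq> 0"
    using det by (auto simp: norm1_def det2_def add_nonneg_eq_0_iff)
  then have "norm1 w1 \<ge> 1" "norm1 w2 \<ge> 1"
    unfolding norm1_def by linarith+
  ultimately have *: "(p - 1) * norm1 w1 + (q - 1) * norm1 w2 \<le> 0" "norm1 w1 \<ge> 1" "norm1 w2 \<ge> 1"
    using short by (simp_all add: algebra_simps)
  have "(p - 1) * 1 \<le> (p - 1) * norm1 w1" "(q - 1) * 1 \<le> (q - 1) * norm1 w2"
    using * pq by (intro mult_left_mono; linarith)+
  from order_trans[OF add_mono[OF this] *(1)] have "p \<le> 1" "q \<le> 1" using pq by simp_all
  then have "p = 1" "q = 1" using pq by auto
  then show ?thesis using v by (simp add: prod_eq_iff)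
qed

text \<open>A segment in the cone and no longer than the diagonal would be a translate of it, and
  parallel segments do not cross properly.\<close>

lemma short_crossing_off_cone:
  assumes det: "det2 w1 w2 = 1"
    and quad: "fst w1 * fst w2 \<ge> 0" "snd w1 * snd w2 \<ge> 0"
    and short: "norm1 (F - G) \<le> norm1 (w1 + w2)"
    and ef: "proper_cross a (a + w1 + w2) F G"
  shows "det2 (F - G) w2 * det2 w1 (F - G) \<le> 0"
proof (rule ccontr)
  assume "\<not> ?thesis"
  moreover have "det2 (G - F) w2 = - det2 (F - G) w2" "det2 w1 (G - F) = - det2 w1 (F - G)"
    by (simp_all add: det2_def algebra_simps)
  ultimately consider "det2 (F - G) w2 > 0" "det2 w1 (F - G) > 0"
    | "det2 (G - F) w2 > 0" "det2 w1 (G - F) > 0"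
    by (auto simp: not_le zero_less_mult_iff)
  then have "F - G = w1 + w2 \<or> G - F = w1 + w2"
  proof cases
    case 1
    then show ?thesis using short_vector_in_cone[OF det quad short] by blast
  next
    case 2
    have "norm1 (G - F) \<le> norm1 (w1 + w2)"
      using short by (simp add: norm1_def abs_minus_commute)
    then show ?thesis using short_vector_in_cone[OF det quad _ 2] by blast
  qed
  then have "orient a (a + w1 + w2) F = orient a (a + w1 + w2) G"
  proof
    assume *: "F - G = w1 + w2"
    then have F: "F = G + (w1 + w2)" by (simp add: algebra_simps)
    show ?thesis unfolding F by (simp add: orient_def det2_def algebra_simps)
  next
    assume *: "G - F = w1 + w2"
    then have G: "G = F + (w1 + w2)" by (simp add: algebra_simps)
    show ?thesis unfolding G by (simp add: orient_def det2_def algebra_simps)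
  qed
  then show False using ef by (simp add: proper_cross_def not_less)
qed

section \<open>Edges as pairs of integer points\<close>

definition lpt :: "ipoint \<Rightarrow> point" where
  "lpt p = (of_int (fst p), of_int (snd p))"

definition iedge :: "ipoint \<Rightarrow> ipoint \<Rightarrow> edge" where
  "iedge a b = Upair (lpt a) (lpt b)"

definition grid :: "nat \<Rightarrow> nat \<Rightarrow> ipoint set" where
  "grid m n = {0..int m} \<times> {0..int n}"

lemma lpt_eq_iff [simp]: "lpt a = lpt b \<longleftrightarrow> a = b"
  by (simp add: lpt_def prod_eq_iff)

lemma integer_points: "\<int> \<times> \<int> = range lpt"
  by (auto simp: lpt_def image_iff elim!: Ints_cases)

lemma lattice_eq: "lattice m n = lpt ` grid m n"
proof (intro equalityI subsetI)
  fix p assume "p \<in> lattice m n"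
  then obtain i j where "p = lpt (int i, int j)" "i \<le> m" "j \<le> n"
    by (auto simp: lattice_def lpt_def)
  then show "p \<in> lpt ` grid m n" by (auto simp: grid_def)
next
  fix p assume "p \<in> lpt ` grid m n"
  then obtain i j where "p = lpt (i, j)" "0 \<le> i" "i \<le> int m" "0 \<le> j" "j \<le> int n"
    by (auto simp: grid_def)
  then have "p = (real (nat i), real (nat j))" "nat i \<le> m" "nat j \<le> n"
    by (auto simp: lpt_def)
  then show "p \<in> lattice m n" unfolding lattice_def by blast
qed

lemma iedge_commute: "iedge b a = iedge a b"
  by (simp add: iedge_def)

lemma iedge_eq_iff: "iedge a b = iedge c d \<longleftrightarrow> a = c \<and> b = d \<or> a = d \<and> b = c"
  by (simp add: iedge_def)

lemma mid_iedge_eq_iff: "mid (iedge a b) = mid (iedge c d) \<longleftrightarrow> a + b = c + d"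
proof -
  have "mid (iedge a b) = mid (iedge c d) \<longleftrightarrow> lpt a + lpt b = lpt c + lpt d"
    by (simp add: iedge_def midpoint_def)
  also have "\<dots> \<longleftrightarrow> lpt (a + b) = lpt (c + d)" by (simp add: lpt_def)
  finally show ?thesis by simp
qed

lemma len_iedge: "len (iedge a b) = of_int (norm1 (b - a))"
  by (simp add: iedge_def lpt_def norm1_def)

lemma segment_param:
  "p \<in> closed_segment (lpt a) (lpt b) \<longleftrightarrow>
    (\<exists>s::real. 0 \<le> s \<and> s \<le> 1 \<and>
      fst p = of_int (fst a) + s * of_int (fst (b - a)) \<and>
      snd p = of_int (snd a) + s * of_int (snd (b - a)))"
  by (auto simp: closed_segment_def lpt_def prod_eq_iff algebra_simps)

lemma primitive_multiple:
  assumes "primitive u" "s * of_int (fst u) \<in> \<int>" "s * of_int (snd u) \<in> \<int>"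
  shows "(s :: real) \<in> \<int>"
proof -
  obtain x y where xy: "x * fst u + y * snd u = 1"
    using assms(1) bezout_int[of "fst u" "snd u"] by (auto simp: primitive_def)
  have "of_int x * of_int (fst u) + of_int y * of_int (snd u) = (1 :: real)"
    using arg_cong[OF xy, of real_of_int] by simp
  then have "s = s * (of_int x * of_int (fst u) + of_int y * of_int (snd u))" by simp
  also have "\<dots> = of_int x * (s * of_int (fst u)) + of_int y * (s * of_int (snd u))"
    by (simp add: algebra_simps)
  also have "\<dots> \<in> \<int>"
    by (rule Ints_add[OF Ints_mult[OF Ints_of_int assms(2)] Ints_mult[OF Ints_of_int assms(3)]])
  finally show ?thesis .
qed

lemma primitive_parallel:
  assumes u: "primitive u" and v: "primitive v" and par: "det2 u v = 0"
  shows "v = u \<or> v = - u"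
proof -
  obtain x y where xy: "x * fst u + y * snd u = 1"
    using u bezout_int[of "fst u" "snd u"] by (auto simp: primitive_def)
  define k where "k = x * fst v + y * snd v"
  have "fst v * (x * fst u + y * snd u) = k * fst u + y * - det2 u v"
    "snd v * (x * fst u + y * snd u) = k * snd u + x * det2 u v"
    by (simp_all add: k_def det2_def algebra_simps)
  then have k: "fst v = k * fst u" "snd v = k * snd u" by (simp_all add: xy par)
  then have "k dvd 1" using v unfolding primitive_def coprime_def by (metis dvd_triv_left)
  then have "k = 1 \<or> k = -1" by auto
  then show ?thesis using k by (auto simp: prod_eq_iff)
qed

text \<open>An integer point of the segment has a parameter \<open>s\<close> for which \<open>s *
  (b - a)\<close> is an integer vector; if \<open>b - a\<close> is primitive, Bezout's identity
  makes \<open>s\<close> itself an integer. Conversely, dividing by the greatest common divisor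
  produces an interior integer point.\<close>

lemma primitive_iff_no_interior_integer_points:
  "a \<noteq> b \<and> closed_segment (lpt a) (lpt b) \<inter> (\<int> \<times> \<int>) = {lpt a, lpt b} \<longleftrightarrow> primitive (b - a)"
proof
  assume prim: "primitive (b - a)"
  have "p \<in> {lpt a, lpt b}" if p: "p \<in> closed_segment (lpt a) (lpt b)" "p \<in> \<int> \<times> \<int>" for p
  proof -
    obtain s where s: "0 \<le> s" "s \<le> 1" "fst p = of_int (fst a) + s * of_int (fst (b - a))"
      "snd p = of_int (snd a) + s * of_int (snd (b - a))"
      using p(1) unfolding segment_param by blast
    have "fst p \<in> \<int>" "snd p \<in> \<int>" using p(2) by auto
    moreover have "s * of_int (fst (b - a)) = fst p - of_int (fst a)"
      "s * of_int (snd (b - a)) = snd p - of_int (snd a)" using s by simp_all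
    ultimately have "s * of_int (fst (b - a)) \<in> \<int>" "s * of_int (snd (b - a)) \<in> \<int>"
      by (simp_all only: Ints_diff Ints_of_int)
    then have "s \<in> \<int>" by (rule primitive_multiple[OF prim])
    then obtain k where "s = of_int k" by (rule Ints_cases)
    then have "s = 0 \<or> s = 1" using s(1,2) by auto
    then show ?thesis using s(3,4) by (auto simp: lpt_def prod_eq_iff)
  qed
  moreover have "lpt a \<in> \<int> \<times> \<int>" "lpt b \<in> \<int> \<times> \<int>" by (auto simp: integer_points)
  moreover have "a \<noteq> b" using prim by (auto simp: primitive_def)
  ultimately show "a \<noteq> b \<and> closed_segment (lpt a) (lpt b) \<inter> (\<int> \<times> \<int>) = {lpt a, lpt b}"
    by blast
next
  assume "a \<noteq> b \<and> closed_segment (lpt a) (lpt b) \<inter> (\<int> \<times> \<int>) = {lpt a, lpt b}"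
  then have ab: "a \<noteq> b" and ends: "closed_segment (lpt a) (lpt b) \<inter> (\<int> \<times> \<int>) = {lpt a, lpt b}"
    by blast+
  show "primitive (b - a)"
  proof (rule ccontr)
    assume np: "\<not> primitive (b - a)"
    define g where "g = gcd (fst (b - a)) (snd (b - a))"
    have "g \<noteq> 0" "g \<noteq> 1" "g \<ge> 0" using np ab
      by (auto simp: g_def primitive_def coprime_iff_gcd_eq_1 prod_eq_iff)
    then have g: "g \<ge> 2" by linarith
    obtain x y where xy: "fst (b - a) = g * x" "snd (b - a) = g * y"
      using gcd_dvd1[of "fst (b - a)" "snd (b - a)"] gcd_dvd2[of "fst (b - a)" "snd (b - a)"]
      unfolding g_def[symmetric] dvd_def by blast
    have "lpt (a + (x, y)) \<in> closed_segment (lpt a) (lpt b)"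
      unfolding segment_param xy using g
      by (intro exI[of _ "1 / of_int g"]) (auto simp: lpt_def)
    then have "lpt (a + (x, y)) \<in> {lpt a, lpt b}"
      using ends unfolding integer_points by blast
    then have "(x, y) = 0 \<or> (x, y) = b - a" by auto
    then have "x = 0 \<and> y = 0 \<or> x = g * x \<and> y = g * y"
      using xy by (simp only: prod_eq_iff fst_conv snd_conv fst_zero snd_zero)
    then have "x = 0 \<and> y = 0" using g by auto
    then show False using xy ab by (auto simp: prod_eq_iff)
  qed
qed

lemma edges_eq:
  "edges m n = {iedge a b | a b. a \<in> grid m n \<and> b \<in> grid m n \<and> primitive (b - a)}"
  (is "_ = ?R")
proof (intro equalityI subsetI)
  fix e assume "e \<in> edges m n"
  then obtain p q where pq: "e = Upair p q" "p \<in> lattice m n" "q \<in> lattice m n" "p \<noteq> q"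
    "closed_segment p q \<inter> (\<int> \<times> \<int>) = {p, q}"
    unfolding edges_def by blast
  then obtain a b where ab: "p = lpt a" "q = lpt b" "a \<in> grid m n" "b \<in> grid m n"
    unfolding lattice_eq by blast
  have "primitive (b - a)"
    using pq(4,5) unfolding ab primitive_iff_no_interior_integer_points[symmetric] by simp
  then show "e \<in> ?R" using pq(1) ab unfolding iedge_def by blast
next
  fix e assume "e \<in> ?R"
  then obtain a b where ab: "e = iedge a b" "a \<in> grid m n" "b \<in> grid m n" "primitive (b - a)"
    by blast
  then show "e \<in> edges m n"
    using ab(4)[folded primitive_iff_no_interior_integer_points] imageI[of _ "grid m n" lpt]
    unfolding edges_def iedge_def lattice_eq by (smt (verit) lpt_eq_iff mem_Collect_eq)
qed

lemma edgesE:
  assumes "e \<in> edges m n"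
  obtains a b where "e = iedge a b" "a \<in> grid m n" "b \<in> grid m n" "primitive (b - a)"
  using assms unfolding edges_eq by blast

lemma iedge_in_edges_iff:
  "iedge a b \<in> edges m n \<longleftrightarrow> a \<in> grid m n \<and> b \<in> grid m n \<and> primitive (b - a)"
proof
  assume "iedge a b \<in> edges m n"
  then obtain c d where cd: "iedge a b = iedge c d" "c \<in> grid m n" "d \<in> grid m n" "primitive (d - c)"
    by (rule edgesE)
  moreover have "primitive (c - d) = primitive (d - c)" using primitive_uminus[of "d - c"] by simp
  ultimately show "a \<in> grid m n \<and> b \<in> grid m n \<and> primitive (b - a)"
    by (auto simp: iedge_eq_iff)
qed (unfold edges_eq, blast)

text \<open>Cramer's rule gives the parameters \<open>s\<close> and \<open>t\<close> of the
  intersection of the two lines, and the sign conditions say that both lie strictly between 0 and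
  1.\<close>

lemma proper_cross_imp_crosses:
  assumes "proper_cross a b c d"
  shows "crosses (iedge a b) (iedge c d)"
proof -
  define \<delta> where "\<delta> = det2 (b - a) (d - c)"
  define D E where "D = orient c d a" and "E = orient a b c"
  have D2: "orient c d b = D - \<delta>" and E2: "orient a b d = E + \<delta>"
    by (simp_all add: D_def E_def \<delta>_def orient_def det2_def algebra_simps)
  have sgn: "D * (D - \<delta>) < 0" "E * (E + \<delta>) < 0"
    using assms by (simp_all add: proper_cross_def D2 E2 flip: D_def E_def)
  have \<delta>: "\<delta> \<noteq> 0" using sgn(1) by (auto simp: not_less)
  define s t :: real where "s = of_int D / of_int \<delta>" and "t = - (of_int E / of_int \<delta>)"
  have s: "0 < s" "s < 1" and t: "0 < t" "t < 1"
    using sgn by (auto simp: s_def t_def mult_less_0_iff divide_simps)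
  have "\<delta> * fst a + D * fst (b - a) = \<delta> * fst c - E * fst (d - c)"
    "\<delta> * snd a + D * snd (b - a) = \<delta> * snd c - E * snd (d - c)"
    by (simp_all add: \<delta>_def D_def E_def orient_def det2_def algebra_simps)
  then have "of_int \<delta> * of_int (fst a) + of_int D * of_int (fst (b - a))
      = (of_int \<delta> * of_int (fst c) - of_int E * of_int (fst (d - c)) :: real)"
    "of_int \<delta> * of_int (snd a) + of_int D * of_int (snd (b - a))
      = (of_int \<delta> * of_int (snd c) - of_int E * of_int (snd (d - c)) :: real)"
    by (metis of_int_add of_int_diff of_int_mult)+
  then have eq: "of_int (fst a) + s * of_int (fst (b - a)) = of_int (fst c) + t * of_int (fst (d - c))"
    "of_int (snd a) + s * of_int (snd (b - a)) = of_int (snd c) + t * of_int (snd (d - c))"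
    using \<delta> by (simp_all add: s_def t_def field_simps)
  define p where "p = (of_int (fst a) + s * of_int (fst (b - a)), of_int (snd a) + s * of_int (snd (b - a)))"
  have "p \<in> segment (iedge a b)"
    using s unfolding iedge_def segment_Upair segment_param p_def by (intro exI[of _ s]) auto
  moreover have "p \<in> segment (iedge c d)"
    using t unfolding iedge_def segment_Upair segment_param p_def eq by (intro exI[of _ t]) auto
  moreover have "p \<notin> set_uprod (iedge a b)"
  proof
    assume "p \<in> set_uprod (iedge a b)"
    then have "p = lpt a \<or> p = lpt b" by (simp add: iedge_def)
    then have "b = a"
    proof
      assume "p = lpt a"
      then show "b = a" using s by (auto simp: p_def lpt_def prod_eq_iff)
    next
      assume "p = lpt b"
      then have "(1 - s) * of_int (fst (b - a)) = 0" "(1 - s) * of_int (snd (b - a)) = 0"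
        by (auto simp: p_def lpt_def algebra_simps)
      then show "b = a" using s by (auto simp: prod_eq_iff)
    qed
    then show False using \<delta> by (simp add: \<delta>_def det2_def)
  qed
  moreover have "iedge a b \<noteq> iedge c d"
    using assms by (auto simp: iedge_eq_iff proper_cross_def orient_def det2_def)
  ultimately show ?thesis by (auto simp: crosses_def)
qed

text \<open>An integer point common to both segments is an endpoint of each, so the point at which
  the edges cross is noninteger and interior to both. The segments are not parallel: parallel
  primitive vectors agree up to sign, and two collinear primitive segments sharing a noninteger
  point coincide.\<close>

lemma crosses_imp_proper_cross:
  assumes "iedge a b \<in> edges m n" "iedge c d \<in> edges m n" "crosses (iedge a b) (iedge c d)"
  shows "proper_cross a b c d"
proof -
  have prim: "primitive (b - a)" "primitive (d - c)"
    using assms(1,2) by (auto simp: iedge_in_edges_iff)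
  note ends = prim[THEN primitive_iff_no_interior_integer_points[THEN iffD2]]
  obtain p where p: "p \<in> closed_segment (lpt a) (lpt b)" "p \<in> closed_segment (lpt c) (lpt d)"
    "p \<notin> {lpt a, lpt b} \<inter> {lpt c, lpt d}" and ne: "iedge a b \<noteq> iedge c d"
    using assms(3) by (auto simp: crosses_def iedge_def)
  then have p_nonint: "p \<notin> \<int> \<times> \<int>" using ends by blast
  then have p_ends: "p \<noteq> lpt a" "p \<noteq> lpt b" "p \<noteq> lpt c" "p \<noteq> lpt d" by (auto simp: integer_points)
  define u v where "u = b - a" and "v = d - c"
  obtain s where s: "0 \<le> s" "s \<le> 1" "fst p = of_int (fst a) + s * of_int (fst u)"
    "snd p = of_int (snd a) + s * of_int (snd u)"
    using p(1) unfolding segment_param u_def by blast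
  obtain t where t: "0 \<le> t" "t \<le> 1" "fst p = of_int (fst c) + t * of_int (fst v)"
    "snd p = of_int (snd c) + t * of_int (snd v)"
    using p(2) unfolding segment_param v_def by blast
  have "s \<noteq> 0" "s \<noteq> 1" "t \<noteq> 0" "t \<noteq> 1"
    using s(3,4) t(3,4) p_ends by (auto simp: u_def v_def lpt_def prod_eq_iff)
  then have st: "0 < s" "s < 1" "0 < t" "t < 1" using s(1,2) t(1,2) by auto
  have ca: "real_of_int (fst c) - real_of_int (fst a) = s * of_int (fst u) - t * of_int (fst v)"
    "real_of_int (snd c) - real_of_int (snd a) = s * of_int (snd u) - t * of_int (snd v)"
    using s(3,4) t(3,4) by linarith+
  define \<delta> where "\<delta> = det2 u v"
  have "\<delta> \<noteq> 0"
  proof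
    assume "\<delta> = 0"
    then have "v = u \<or> v = - u"
      using primitive_parallel[OF prim] by (simp add: \<delta>_def u_def v_def)
    then consider "v = u" | "v = - u" by blast
    then have "iedge a b = iedge c d"
    proof cases
      case 1
      have "(s - t) * of_int (fst u) = of_int (fst c - fst a)"
        "(s - t) * of_int (snd u) = of_int (snd c - snd a)"
        using ca 1 by (simp_all add: algebra_simps)
      then have "(s - t) * of_int (fst u) \<in> \<int>" "(s - t) * of_int (snd u) \<in> \<int>"
        by (simp_all only: Ints_of_int)
      then have "s - t \<in> \<int>" by (rule primitive_multiple[OF prim(1)[folded u_def]])
      then obtain k where k: "s - t = of_int k" by (rule Ints_cases)
      have "k = 0" using k st by linarith
      then have "s - t = 0" using k by simp
      then have "c = a" using ca 1 by (simp add: prod_eq_iff)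
      then show ?thesis using 1 by (auto simp: u_def v_def)
    next
      case 2
      have "(s + t) * of_int (fst u) = of_int (fst c - fst a)"
        "(s + t) * of_int (snd u) = of_int (snd c - snd a)"
        using ca 2 by (simp_all add: algebra_simps)
      then have "(s + t) * of_int (fst u) \<in> \<int>" "(s + t) * of_int (snd u) \<in> \<int>"
        by (simp_all only: Ints_of_int)
      then have "s + t \<in> \<int>" by (rule primitive_multiple[OF prim(1)[folded u_def]])
      then obtain k where k: "s + t = of_int k" by (rule Ints_cases)
      have "k = 1" using k st by linarith
      then have "s + t = 1" using k by simp
      then have "c = a + u" using ca 2 by (simp add: prod_eq_iff algebra_simps flip: distrib_right)
      then have "c = b" "d = a" using 2 by (simp_all add: u_def v_def algebra_simps)
      then show ?thesis by (simp add: iedge_eq_iff)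
    qed
    then show False using ne by contradiction
  qed
  have 1: "real_of_int (orient a b c) = - t * of_int \<delta>"
  proof -
    have "real_of_int (orient a b c) 
        = of_int (fst u) * (real_of_int (snd c) - real_of_int (snd a))
          - of_int (snd u) * (real_of_int (fst c) - real_of_int (fst a))"
      by (simp add: orient_def det2_def u_def)
    then show ?thesis unfolding ca by (simp add: \<delta>_def det2_def algebra_simps)
  qed
  have 2: "real_of_int (orient c d a) = s * of_int \<delta>"
  proof -
    have "real_of_int (orient c d a) 
        = - (of_int (fst v) * (real_of_int (snd c) - real_of_int (snd a))
          - of_int (snd v) * (real_of_int (fst c) - real_of_int (fst a)))"
      by (simp add: orient_def det2_def v_def algebra_simps)
    then show ?thesis unfolding ca by (simp add: \<delta>_def det2_def algebra_simps)
  qed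
  have 3: "orient a b d = orient a b c + \<delta>" "orient c d b = orient c d a - \<delta>"
    by (simp_all add: orient_def det2_def \<delta>_def u_def v_def algebra_simps)
  have "real_of_int (orient a b c * orient a b d) = - (t * (1 - t)) * (of_int \<delta> * of_int \<delta>)"
    by (simp add: 3 1 algebra_simps)
  moreover have "real_of_int (orient c d a * orient c d b) = - (s * (1 - s)) * (of_int \<delta> * of_int \<delta>)"
    by (simp add: 3 2 algebra_simps)
  moreover have "real_of_int \<delta> * real_of_int \<delta> > 0" using \<open>\<delta> \<noteq> 0\<close> by (metis not_real_square_gt_zero of_int_eq_0_iff)
  ultimately have "real_of_int (orient a b c * orient a b d) < 0" "real_of_int (orient c d a * orient c d b) < 0"
    using st by (simp_all add: mult_pos_pos)
  then show ?thesis unfolding proper_cross_def by (metis of_int_less_0_iff)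
qed

lemma crosses_commute: "crosses e f = crosses f e"
  by (auto simp: crosses_def)

text \<open>The midpoint is a common point of both edges and an endpoint of neither.\<close>

lemma crosses_if_same_mid:
  assumes "e \<in> edges m n" "f \<in> edges m n" "mid e = mid f" "e \<noteq> f"
  shows "crosses e f"
proof -
  obtain a b where ab: "e = iedge a b" "primitive (b - a)" using assms(1) edgesE by metis
  obtain c d where cd: "f = iedge c d" "primitive (d - c)" using assms(2) edgesE by metis
  have "lpt a \<noteq> lpt b" using ab by (auto simp: primitive_def)
  then have "mid e \<notin> set_uprod e"
    by (simp add: ab iedge_def)
  moreover have "mid e \<in> segment e" using ab by (simp add: iedge_def)
  moreover have "mid e \<in> segment f" using cd assms(3) by (simp add: iedge_def)
  ultimately show ?thesis using assms(4) unfolding crosses_def by blast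
qed

section \<open>Flips and constrained edges\<close>

text \<open>The flip on which everything rests. The edge \<open>iedge c d\<close> may be thought
  of as a certificate: its crossing with the old edge guarantees that the new one stays in the
  grid and that every edge crossing the new one already crosses the old edge or the
  certificate.\<close>

lemma flip:
  assumes det: "det2 w1 w2 = 1"
    and e: "iedge a (a + w1 + w2) \<in> edges m n" and f: "iedge c d \<in> edges m n"
    and ef: "crosses (iedge a (a + w1 + w2)) (iedge c d)"
    and cone: "det2 (c - d) w2 * det2 w1 (c - d) \<le> 0"
  shows "iedge (a + w1) (a + w2) \<in> edges m n"
    and "mid (iedge (a + w1) (a + w2)) = mid (iedge a (a + w1 + w2))"
    and "h \<in> edges m n \<Longrightarrow> crosses (iedge (a + w1) (a + w2)) h \<Longrightarrow>
      crosses (iedge a (a + w1 + w2)) h \<or> crosses (iedge c d) h"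
proof -
  have pc: "proper_cross a (a + w1 + w2) c d"
    using crosses_imp_proper_cross[OF e f ef] .
  have grid: "p \<in> grid m n" if "p = a \<or> p = a + w1 + w2 \<or> p = c \<or> p = d" for p
    using e f that by (auto simp: iedge_in_edges_iff)
  note half = flipped_in_half_plane[OF det pc cone]
  have "a + w1 \<in> grid m n \<and> a + w2 \<in> grid m n"
  proof -
    have *: "0 \<le> fst p \<and> fst p \<le> int m \<and> 0 \<le> snd p \<and> snd p \<le> int n"
      if "p = a \<or> p = a + w1 + w2 \<or> p = c \<or> p = d" for p
      using grid[OF that] by (simp add: grid_def mem_Times_iff)
    note pts = *[of a] *[of "a + w1 + w2"] *[of c] *[of d]
    have "fst (a + w1) \<ge> 0 \<and> fst (a + w2) \<ge> 0"
      using half[of 0 1 0] pts by auto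
    moreover have "fst (a + w1) \<le> int m \<and> fst (a + w2) \<le> int m"
      using half[of "- int m" "-1" 0] pts by auto
    moreover have "snd (a + w1) \<ge> 0 \<and> snd (a + w2) \<ge> 0"
      using half[of 0 0 1] pts by auto
    moreover have "snd (a + w1) \<le> int n \<and> snd (a + w2) \<le> int n"
      using half[of "- int n" 0 "-1"] pts by auto
    ultimately show ?thesis by (simp add: grid_def mem_Times_iff)
  qed
  moreover have "primitive (w2 - w1)"
    using det by (intro primitive_det1[of _ "- w1"]) (simp add: det2_def algebra_simps)
  ultimately show e': "iedge (a + w1) (a + w2) \<in> edges m n"
    by (simp add: iedge_in_edges_iff)
  show "mid (iedge (a + w1) (a + w2)) = mid (iedge a (a + w1 + w2))"
    by (simp add: mid_iedge_eq_iff algebra_simps)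
  show "crosses (iedge a (a + w1 + w2)) h \<or> crosses (iedge c d) h"
    if h: "h \<in> edges m n" and cr: "crosses (iedge (a + w1) (a + w2)) h"
  proof -
    obtain A B where AB: "h = iedge A B" using h by (rule edgesE)
    have "proper_cross (a + w1) (a + w2) A B"
      using crosses_imp_proper_cross[OF e' h[unfolded AB] cr[unfolded AB]] .
    from flipped_crossing[OF det pc cone this] show ?thesis
      unfolding AB by (blast intro: proper_cross_imp_crosses)
  qed
qed

lemma finite_edges: "finite (edges m n)"
proof -
  have "edges m n \<subseteq> (\<lambda>(a, b). iedge a b) ` (grid m n \<times> grid m n)"
    unfolding edges_eq by auto
  then show ?thesis by (rule finite_subset) (simp add: grid_def)
qed

lemma finite_midpoints: "finite (midpoints m n)"
proof -
  have "midpoints m n \<subseteq> (\<lambda>(i, j). (real i / 2, real j / 2)) ` ({..2 * m} \<times> {..2 * n})"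
    unfolding midpoints_def by auto
  then show ?thesis by (rule finite_subset) simp
qed

lemma mid_in_midpoints:
  assumes "e \<in> edges m n"
  shows "mid e \<in> midpoints m n"
proof -
  obtain a b where ab: "e = iedge a b" "a \<in> grid m n" "b \<in> grid m n" "primitive (b - a)"
    using assms by (rule edgesE)
  define i j where "i = nat (fst a + fst b)" and "j = nat (snd a + snd b)"
  have "i \<le> 2 * m" "j \<le> 2 * n" and "mid e = (real i / 2, real j / 2)"
    using ab(2,3) by (auto simp: ab(1) iedge_def midpoint_def lpt_def i_def j_def grid_def)
  moreover have "mid e \<notin> lattice m n"
  proof
    assume "mid e \<in> lattice m n"
    moreover have "mid e \<in> closed_segment (lpt a) (lpt b)" by (simp add: ab(1) iedge_def)
    ultimately have "mid e \<in> {lpt a, lpt b}"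
      using ab(4)[folded primitive_iff_no_interior_integer_points]
      unfolding lattice_eq integer_points by blast
    then show False
      using ab(4)[folded primitive_iff_no_interior_integer_points] by (auto simp: ab(1) iedge_def)
  qed
  ultimately show ?thesis unfolding midpoints_def by blast
qed

text \<open>Rounding both coordinates of \<open>x\<close> down and up gives the endpoints: of a
  unit edge if one coordinate of \<open>x\<close> is an integer, of a unit diagonal if none
  is.\<close>

lemma exists_edge_at:
  assumes "x \<in> midpoints m n"
  shows "\<exists>e \<in> edges m n. mid e = x"
proof -
  obtain i j where ij: "x = (real i / 2, real j / 2)" "i \<le> 2 * m" "j \<le> 2 * n"
    and nl: "x \<notin> lattice m n"
    using assms unfolding midpoints_def by blast
  have odd: "odd i \<or> odd j"
  proof (rule ccontr)
    assume "\<not> (odd i \<or> odd j)"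
    then obtain k l where "i = 2 * k" "j = 2 * l" by (auto elim!: evenE)
    then show False using ij nl by (auto simp: lattice_def)
  qed
  define a b where "a = (int (i div 2), int (j div 2))"
    and "b = (int ((i + 1) div 2), int ((j + 1) div 2))"
  have ab: "b - a = (int (i mod 2), int (j mod 2))"
    by (auto simp: a_def b_def) presburger+
  have "primitive (b - a)"
    unfolding ab using odd by (auto simp: primitive_def odd_iff_mod_2_eq_one)
  moreover have "a \<in> grid m n" "b \<in> grid m n"
    using ij by (auto simp: a_def b_def grid_def)
  moreover have "mid (iedge a b) = x"
  proof -
    have "i div 2 + (i + 1) div 2 = i" "j div 2 + (j + 1) div 2 = j" by presburger+
    then have "real (i div 2) + real ((i + 1) div 2) = real i"
      "real (j div 2) + real ((j + 1) div 2) = real j"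
      by (metis of_nat_add)+
    then show ?thesis
      by (simp add: iedge_def midpoint_def lpt_def a_def b_def ij(1))
  qed
  ultimately show ?thesis using iedge_in_edges_iff by blast
qed

text \<open>The determinant is the difference of two integers of strictly opposite signs.\<close>

lemma proper_cross_det:
  assumes "proper_cross a b c d"
  shows "\<bar>det2 (d - c) (b - a)\<bar> \<ge> 2"
proof -
  have "det2 (d - c) (b - a) = orient c d b - orient c d a"
    by (simp add: orient_def det2_def algebra_simps)
  moreover have "orient c d a * orient c d b < 0" using assms by (simp add: proper_cross_def)
  ultimately show ?thesis by (auto simp: mult_less_0_iff)
qed

text \<open>Edges are inserted into \<open>H\<close> one at a time. Given a new edge
  \<open>h\<close>, choose among the edges at \<open>x\<close> crossing none of the old ones one
  whose determinant with \<open>h\<close> is smallest in absolute value. If it crossed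
  \<open>h\<close>, it could be flipped with \<open>h\<close> as the crossing edge: the result
  still avoids the old edges, because neither \<open>h\<close> nor the edge before the flip
  crosses them, and it has a smaller determinant. The length of the edge may grow in this
  process.\<close>

lemma exists_edge_at_crossing_none:
  assumes "finite H" "H \<subseteq> edges m n" "noncrossing H" "x \<in> midpoints m n"
  shows "\<exists>e \<in> edges m n. mid e = x \<and> (\<forall>h\<in>H. \<not> crosses e h)"
  using assms(1-3)
proof (induction H rule: finite_induct)
  case empty
  then show ?case using exists_edge_at[OF assms(4)] by simp
next
  case (insert h H)
  have sub: "h \<in> edges m n" "H \<subseteq> edges m n" using insert.prems(1) by auto
  have nc: "(\<forall>k. k \<in> H \<and> k \<noteq> h \<longrightarrow> \<not> crosses h k \<and> \<not> crosses k h) \<and> noncrossing H"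
    using insert.prems(2) unfolding noncrossing_def pairwise_insert .
  have hH: "\<not> crosses h k" if "k \<in> H" for k
  proof -
    have "k \<noteq> h" using that insert.hyps(2) by metis
    then show ?thesis using nc that by simp
  qed
  obtain e0 where e0: "e0 \<in> edges m n" "mid e0 = x \<and> (\<forall>k\<in>H. \<not> crosses e0 k)"
    using insert.IH[OF sub(2) conjunct2[OF nc]] by (rule bexE)
  obtain c0 d0 where h0: "h = iedge c0 d0" using sub(1) by (rule edgesE)
  define Q where "Q = (\<lambda>(a, b). iedge a b \<in> edges m n \<and> mid (iedge a b) = x \<and>
    (\<forall>k\<in>H. \<not> crosses (iedge a b) k))"
  obtain a0 b0 where "e0 = iedge a0 b0" using e0(1) by (rule edgesE)
  then have "Q (a0, b0)" using e0 by (simp add: Q_def)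
  \<comment> \<open>The absolute value makes this independent of the order of the endpoints of
    both edges.\<close>
  define \<mu> where "\<mu> = (\<lambda>(a, b). nat \<bar>det2 (d0 - c0) (b - a)\<bar>)"
  obtain z where z: "Q z" "\<And>z'. Q z' \<Longrightarrow> \<mu> z \<le> \<mu> z'"
    using ex_has_least_nat[of Q, OF \<open>Q (a0, b0)\<close>, of \<mu>] by blast
  obtain a b where z_eq: "z = (a, b)" by (rule prod.exhaust)
  have least: "\<bar>det2 (d0 - c0) (b - a)\<bar> \<le> \<bar>det2 (d0 - c0) (b' - a')\<bar>" if "Q (a', b')" for a' b'
    using z(2)[OF that] by (simp add: \<mu>_def z_eq nat_le_iff)
  let ?e = "iedge a b"
  have e: "?e \<in> edges m n" "mid ?e = x" "\<And>k. k \<in> H \<Longrightarrow> \<not> crosses ?e k"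
    using z(1) unfolding Q_def z_eq by simp_all
  have "\<not> crosses ?e h"
  proof
    assume cr: "crosses ?e h"
    have big0: "\<bar>det2 (d0 - c0) (b - a)\<bar> \<ge> 2"
      by (rule proper_cross_det[OF crosses_imp_proper_cross[OF e(1) sub(1)[unfolded h0] cr[unfolded h0]]])
    have swap: "det2 (c0 - d0) v = - det2 (d0 - c0) v" for v
      by (simp add: det2_def algebra_simps)
    obtain c d where h: "h = iedge c d" and big: "det2 (d - c) (b - a) \<ge> 2"
      and abs_det: "\<And>v. \<bar>det2 (d0 - c0) v\<bar> = \<bar>det2 (d - c) v\<bar>"
    proof (cases "det2 (d0 - c0) (b - a) \<ge> 0")
      case True
      then show ?thesis using that[of c0 d0] h0 big0 by simp
    next
      case False
      then show ?thesis using that[of d0 c0] h0 big0 by (simp add: swap iedge_commute)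
    qed
    have prim: "primitive (b - a)" "primitive (d - c)"
      using e(1) sub(1) by (auto simp: h iedge_in_edges_iff)
    obtain w1 w2 where w: "b - a = w1 + w2" "det2 w1 w2 = 1" "det2 (d - c) w1 > 0" "det2 (d - c) w2 > 0"
      using unimodular_split[OF prim big] .
    have b: "b = a + w1 + w2" using w(1) by (simp add: algebra_simps)
    have "det2 (c - d) w2 = - det2 (d - c) w2" "det2 w1 (c - d) = det2 (d - c) w1"
      by (simp_all add: det2_def algebra_simps)
    then have cone: "det2 (c - d) w2 * det2 w1 (c - d) \<le> 0"
      using w(3,4) by (simp add: mult_le_0_iff)
    note flip = flip[OF w(2) e(1)[unfolded b] sub(1)[unfolded h] cr[unfolded b h] cone, folded b h]
    have "\<not> crosses (iedge (a + w1) (a + w2)) k" if "k \<in> H" for k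
      using flip(3)[of k] e(3)[OF that] hH[OF that] sub(2) that by blast
    then have "Q (a + w1, a + w2)"
      unfolding Q_def using flip(1,2) e(2) by simp
    from least[OF this] have "\<bar>det2 (d - c) (b - a)\<bar> \<le> \<bar>det2 (d - c) (w2 - w1)\<bar>"
      by (simp add: abs_det)
    then show False using w(3,4) unfolding w(1) det2_add_right det2_diff_right by auto
  qed
  then show ?case using e by (intro bexI[of _ ?e]) simp_all
qed

section \<open>Minimal configurations\<close>

text \<open>The shorter edge serves as the crossing edge for a flip of the longer one; constraint
  edges cross neither of the two, hence not the flipped edge.\<close>

lemma consistent_flip:
  assumes con: "constraints m n \<eta> \<Delta>"
    and e: "consistent_configuration m n \<eta> \<Delta> x e" and f: "consistent_configuration m n \<eta> \<Delta> y f"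
    and ef: "crosses e f" and le: "len f \<le> len e" and big: "len e > 2"
  shows "\<exists>e'. consistent_configuration m n \<eta> \<Delta> x e' \<and> len e' < len e"
proof -
  obtain a b where ab: "e = iedge a b" "primitive (b - a)"
    using e unfolding consistent_configuration_def by (meson edgesE)
  obtain c d where cd: "f = iedge c d"
    using f unfolding consistent_configuration_def by (meson edgesE)
  have "norm1 (b - a) \<ge> 3" using big by (simp add: ab len_iedge)
  then obtain w1 w2 where w: "b - a = w1 + w2" "det2 w1 w2 = 1"
    "fst w1 * fst w2 \<ge> 0" "snd w1 * snd w2 \<ge> 0" "norm1 (w1 - w2) < norm1 (b - a)"
    using l1_split[OF ab(2)] by metis
  have b: "b = a + w1 + w2" using w(1) by (simp add: algebra_simps)
  have e_in: "iedge a (a + w1 + w2) \<in> edges m n" and f_in: "iedge c d \<in> edges m n"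
    using e f by (auto simp: consistent_configuration_def ab cd b)
  have cr: "crosses (iedge a (a + w1 + w2)) (iedge c d)" using ef by (simp add: ab cd b)
  have "norm1 (c - d) \<le> norm1 (w1 + w2)"
    using le by (simp add: ab cd len_iedge w(1)[symmetric]) (simp add: norm1_def abs_minus_commute)
  then have cone: "det2 (c - d) w2 * det2 w1 (c - d) \<le> 0"
    using short_crossing_off_cone[OF w(2-4)] crosses_imp_proper_cross[OF e_in f_in cr] by blast
  note flip = flip[OF w(2) e_in f_in cr cone, folded b, folded ab(1) cd]
  have "consistent_configuration m n \<eta> \<Delta> x (iedge (a + w1) (a + w2))"
    unfolding consistent_configuration_def
  proof (intro conjI ballI)
    fix y' assume "y' \<in> \<Delta>"
    then have "\<eta> y' \<in> edges m n" "\<not> crosses e (\<eta> y')" "\<not> crosses f (\<eta> y')"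
      using con e f unfolding consistent_configuration_def constraints_def by blast+
    then show "\<not> crosses (iedge (a + w1) (a + w2)) (\<eta> y')" using flip(3) by blast
  qed (use flip(1,2) e in \<open>simp_all add: consistent_configuration_def\<close>)
  moreover have "len (iedge (a + w1) (a + w2)) < len e"
    using w(5) by (simp add: ab len_iedge) (simp add: norm1_def abs_minus_commute)
  ultimately show ?thesis by blast
qed

lemma short_primitive:
  assumes "primitive u" "norm1 u \<le> 2"
  shows "u \<in> {(1, 0), (-1, 0), (0, 1), (0, -1), (1, 1), (1, -1), (-1, 1), (-1, -1)}"
proof -
  obtain p q where u: "u = (p, q)" by fastforce
  have le: "\<bar>p\<bar> + \<bar>q\<bar> \<le> 2"
    using assms(2) by (simp add: u norm1_def)
  have "\<not> (\<bar>p\<bar> = 2 \<and> q = 0)" "\<not> (p = 0 \<and> \<bar>q\<bar> = 2)" "\<not> (p = 0 \<and> q = 0)"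
    using assms(1) by (auto simp: u primitive_def abs_eq_iff)
  then have "p \<in> {-1, 0, 1} \<and> q \<in> {-1, 0, 1} \<and> (p \<noteq> 0 \<or> q \<noteq> 0)"
    using le unfolding insert_iff empty_iff by presburger
  then show ?thesis by (auto simp: u)
qed

text \<open>Proper crossing forces the determinant of the two vectors to be at least 2 in absolute
  value, which leaves two diagonals of different slope; the orientations then determine their
  relative position.\<close>

lemma short_proper_cross:
  assumes "primitive (b - a)" "primitive (d - c)" "norm1 (b - a) \<le> 2" "norm1 (d - c) \<le> 2"
    and pc: "proper_cross a b c d"
  shows "a + b = c + d \<and> unit_diagonal (iedge a b) \<and> unit_diagonal (iedge c d)"
proof -
  define u v where "u = b - a" and "v = d - c"
  have b: "b = a + u" and d: "d = c + v" by (simp_all add: u_def v_def)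
  define x y where "x = fst c - fst a" and "y = snd c - snd a"
  define \<delta> where "\<delta> = det2 u v"
  have big: "\<bar>det2 v u\<bar> \<ge> 2" using proper_cross_det[OF pc] by (simp add: u_def v_def)
  have uv: "u \<in> {(1, 1), (1, -1), (-1, 1), (-1, -1)}" "v \<in> {(1, 1), (1, -1), (-1, 1), (-1, -1)}"
    using short_primitive[OF assms(1,3)] short_primitive[OF assms(2,4)] big
    unfolding u_def[symmetric] v_def[symmetric] by (auto simp: det2_def)
  have diag: "unit_diagonal (iedge p (p + w))" if "w \<in> {(1, 1), (1, -1), (-1, 1), (-1, -1)}" for p w
  proof -
    note w = that
    obtain i j :: int where "p = (i, j) \<and> w = (1, 1) \<or> p = (i, j + 1) \<and> w = (1, -1) \<or>
        p = (i + 1, j) \<and> w = (-1, 1) \<or> p = (i + 1, j + 1) \<and> w = (-1, -1)"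
    proof -
      consider "w = (1, 1)" | "w = (1, -1)" | "w = (-1, 1)" | "w = (-1, -1)" using w by blast
      then show ?thesis
        using that[of "fst p" "snd p"] that[of "fst p" "snd p - 1"]
          that[of "fst p - 1" "snd p"] that[of "fst p - 1" "snd p - 1"]
        by cases simp_all
    qed
    then have "iedge p (p + w) = Upair (of_int i, of_int j) (of_int i + 1, of_int j + 1) \<or>
      iedge p (p + w) = Upair (of_int i + 1, of_int j) (of_int i, of_int j + 1)"
      by (elim disjE conjE) (simp_all add: iedge_def lpt_def)
    then show ?thesis unfolding unit_diagonal_def by blast
  qed
  \<comment> \<open>\<open>K\<close> and \<open>L\<close> are the orientations of \<open>c\<close>
    relative to the first and of \<open>a\<close> relative to the second segment; crossing forces
    each to be half the determinant up to sign.\<close>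
  define K L where "K = fst u * y - snd u * x" and "L = snd v * x - fst v * y"
  have "K * (K + \<delta>) < 0" "L * (L - \<delta>) < 0"
    using pc by (simp_all add: proper_cross_def orient_def b d K_def L_def \<delta>_def x_def y_def det2_def algebra_simps)
  moreover have "\<delta> = 2 \<or> \<delta> = -2"
    using uv big by (auto simp: \<delta>_def det2_def)
  ultimately have "\<delta> = 2 \<and> K = -1 \<and> L = 1 \<or> \<delta> = -2 \<and> K = 1 \<and> L = -1"
    by (auto simp: mult_less_0_iff)
  then have "2 * x = fst u - fst v \<and> 2 * y = snd u - snd v"
    using uv by (auto simp: K_def L_def \<delta>_def det2_def)
  then have "a + b = c + d" by (auto simp: b d x_def y_def prod_eq_iff)
  then show ?thesis using diag[OF uv(1)] diag[OF uv(2)] by (simp add: b d)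
qed

text \<open>By the flip, two crossing minimal configurations have length at most 2, and edges that
  short cross only as the two diagonals of a unit square.\<close>

lemma crossing_minimal_configurations:
  assumes con: "constraints m n \<eta> \<Delta>"
    and e: "minimal_configuration m n \<eta> \<Delta> x e" and f: "minimal_configuration m n \<eta> \<Delta> y f"
    and ef: "crosses e f"
  shows "x = y \<and> unit_diagonal e \<and> unit_diagonal f"
proof -
  have e_con: "consistent_configuration m n \<eta> \<Delta> x e" and f_con: "consistent_configuration m n \<eta> \<Delta> y f"
    and e_min: "\<not> (\<exists>e'. consistent_configuration m n \<eta> \<Delta> x e' \<and> len e' < len e)"
    and f_min: "\<not> (\<exists>f'. consistent_configuration m n \<eta> \<Delta> y f' \<and> len f' < len f)"
    using e f unfolding minimal_configuration_def is_arg_min_def by blast+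
  have fe: "crosses f e" using ef crosses_commute by blast
  have short: "len e \<le> 2 \<and> len f \<le> 2"
  proof (cases "len f \<le> len e")
    case True
    then have "\<not> len e > 2" using consistent_flip[OF con e_con f_con ef True] e_min by blast
    with True show ?thesis by simp
  next
    case False
    then have le: "len e \<le> len f" by simp
    then have "\<not> len f > 2" using consistent_flip[OF con f_con e_con fe le] f_min by blast
    with le show ?thesis by simp
  qed
  have in_edges: "e \<in> edges m n" "f \<in> edges m n" and mids: "mid e = x" "mid f = y"
    using e_con f_con unfolding consistent_configuration_def by blast+
  obtain a b where ab: "e = iedge a b" "primitive (b - a)" using in_edges(1) by (rule edgesE)
  obtain c d where cd: "f = iedge c d" "primitive (d - c)" using in_edges(2) by (rule edgesE)
  have "norm1 (b - a) \<le> 2" "norm1 (d - c) \<le> 2"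
    using short by (simp_all add: ab cd len_iedge)
  moreover have "proper_cross a b c d"
    using crosses_imp_proper_cross[OF in_edges[unfolded ab(1) cd(1)] ef[unfolded ab(1) cd(1)]] .
  ultimately have "a + b = c + d \<and> unit_diagonal e \<and> unit_diagonal f"
    unfolding ab(1) cd(1) by (rule short_proper_cross[OF ab(2) cd(2)])
  moreover have "mid e = mid f \<longleftrightarrow> a + b = c + d" unfolding ab(1) cd(1) by (rule mid_iedge_eq_iff)
  ultimately show ?thesis using mids by blast
qed

lemma exists_minimal_configuration:
  assumes con: "constraints m n \<eta> \<Delta>" and x: "x \<in> midpoints m n"
  shows "\<exists>e. minimal_configuration m n \<eta> \<Delta> x e"
proof -
  let ?S = "{e. consistent_configuration m n \<eta> \<Delta> x e}"
  have \<Delta>: "\<Delta> \<subseteq> midpoints m n" and \<eta>: "\<forall>x\<in>\<Delta>. \<eta> x \<in> edges m n \<and> mid (\<eta> x) = x"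
    and nc: "noncrossing (\<eta> ` \<Delta>)"
    using con unfolding constraints_def by simp_all
  have fin: "finite (\<eta> ` \<Delta>)" using finite_subset[OF \<Delta> finite_midpoints] by (rule finite_imageI)
  have sub: "\<eta> ` \<Delta> \<subseteq> edges m n" using \<eta> by (simp add: image_subset_iff)
  obtain e where "e \<in> edges m n" "mid e = x \<and> (\<forall>h \<in> \<eta> ` \<Delta>. \<not> crosses e h)"
    using exists_edge_at_crossing_none[OF fin sub nc x] by (rule bexE)
  then have "e \<in> ?S" by (simp add: consistent_configuration_def)
  then have ne: "?S \<noteq> {}" by (metis empty_iff)
  have fin_S: "finite ?S"
    by (rule finite_subset[OF _ finite_edges[of m n]]) (simp add: consistent_configuration_def subset_iff)
  show ?thesis
    using ex_is_arg_min_if_finite[OF fin_S ne, of len] by (simp add: minimal_configuration_def)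
qed

section \<open>Triangulations and ground states\<close>

lemma noncrossingD:
  assumes "noncrossing E" "e \<in> E" "f \<in> E"
  shows "\<not> crosses e f"
  using assms unfolding noncrossing_def pairwise_def crosses_def by metis

text \<open>A triangulation without an edge at \<open>x\<close> could be enlarged by an edge at
  \<open>x\<close> crossing none of its edges.\<close>

lemma triangulation_unique_edge_at:
  assumes \<sigma>: "triangulation m n \<sigma>" and x: "x \<in> midpoints m n"
  shows "\<exists>!e. e \<in> \<sigma> \<and> mid e = x"
proof (rule ex_ex1I)
  have sub: "\<sigma> \<subseteq> edges m n" and nc: "noncrossing \<sigma>"
    and max: "\<And>E. E \<subseteq> edges m n \<Longrightarrow> noncrossing E \<Longrightarrow> \<sigma> \<subseteq> E \<Longrightarrow> E = \<sigma>"
    using \<sigma> unfolding triangulation_def by blast+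
  obtain e where e: "e \<in> edges m n" "mid e = x" "\<forall>h\<in>\<sigma>. \<not> crosses e h"
    using exists_edge_at_crossing_none[OF finite_subset[OF sub finite_edges] sub nc x] by blast
  have "noncrossing (insert e \<sigma>)"
    using nc e(3) unfolding noncrossing_def pairwise_insert crosses_commute[of _ e] by simp
  then have "insert e \<sigma> = \<sigma>" using max[of "insert e \<sigma>"] sub e(1) by blast
  then show "\<exists>e. e \<in> \<sigma> \<and> mid e = x" using e(2) by blast
  fix f g assume "f \<in> \<sigma> \<and> mid f = x" "g \<in> \<sigma> \<and> mid g = x"
  then show "f = g"
    using crosses_if_same_mid[of f m n g] noncrossingD[OF nc, of f g] sub by auto
qed

lemma edge_at:
  assumes "triangulation m n \<sigma>" "x \<in> midpoints m n"
  shows "edge_at \<sigma> x \<in> \<sigma>" "mid (edge_at \<sigma> x) = x"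
  using theI'[OF triangulation_unique_edge_at[OF assms]] unfolding edge_at_def by auto

lemma edge_at_mid:
  assumes \<sigma>: "triangulation m n \<sigma>" and e: "e \<in> \<sigma>"
  shows "edge_at \<sigma> (mid e) = e"
proof -
  have "mid e \<in> midpoints m n"
    using \<sigma> e mid_in_midpoints unfolding triangulation_def by blast
  then show ?thesis
    using triangulation_unique_edge_at[OF \<sigma>] edge_at[OF \<sigma>] e by blast
qed

lemma triangulation_eq_edge_at_image:
  assumes "triangulation m n \<sigma>"
  shows "\<sigma> = edge_at \<sigma> ` midpoints m n"
proof (intro equalityI subsetI)
  fix e assume e: "e \<in> \<sigma>"
  then have "mid e \<in> midpoints m n"
    using assms mid_in_midpoints unfolding triangulation_def by blast
  then show "e \<in> edge_at \<sigma> ` midpoints m n"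
    using edge_at_mid[OF assms e] by (metis imageI)
next
  fix e assume "e \<in> edge_at \<sigma> ` midpoints m n"
  then show "e \<in> \<sigma>" using edge_at(1)[OF assms] by blast
qed

lemma edge_at_consistent:
  assumes con: "constraints m n \<eta> \<Delta>" and \<sigma>: "\<sigma> \<in> \<Omega> m n \<eta> \<Delta>" and x: "x \<in> midpoints m n"
  shows "consistent_configuration m n \<eta> \<Delta> x (edge_at \<sigma> x)"
proof -
  have tri: "triangulation m n \<sigma>" and on_\<Delta>: "\<And>y. y \<in> \<Delta> \<Longrightarrow> edge_at \<sigma> y = \<eta> y"
    using \<sigma> unfolding \<Omega>_def by blast+
  have sub: "\<sigma> \<subseteq> edges m n" and nc: "noncrossing \<sigma>"
    using tri unfolding triangulation_def by blast+
  have "\<not> crosses (edge_at \<sigma> x) (\<eta> y)" if y: "y \<in> \<Delta>" for y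
  proof -
    have "y \<in> midpoints m n" using con y unfolding constraints_def by blast
    then have "\<eta> y \<in> \<sigma>" using edge_at(1)[OF tri, of y] on_\<Delta>[OF y] by simp
    then show ?thesis using noncrossingD[OF nc edge_at(1)[OF tri x]] by blast
  qed
  then show ?thesis
    using edge_at[OF tri x] sub unfolding consistent_configuration_def by blast
qed

text \<open>No two of the chosen edges cross, since crossing minimal configurations share their
  midpoint. The set is maximal because every midpoint is occupied and edges with a common
  midpoint cross.\<close>

lemma minimal_configurations_triangulate:
  assumes con: "constraints m n \<eta> \<Delta>"
    and \<tau>: "\<And>x. x \<in> midpoints m n \<Longrightarrow> minimal_configuration m n \<eta> \<Delta> x (\<tau> x)"
  shows "\<tau> ` midpoints m n \<in> \<Omega> m n \<eta> \<Delta>"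
    and "x \<in> midpoints m n \<Longrightarrow> edge_at (\<tau> ` midpoints m n) x = \<tau> x"
proof -
  let ?\<sigma> = "\<tau> ` midpoints m n"
  have cons: "consistent_configuration m n \<eta> \<Delta> x (\<tau> x)" if "x \<in> midpoints m n" for x
    using \<tau>[OF that] unfolding minimal_configuration_def is_arg_min_def by blast
  then have in_edges: "\<tau> x \<in> edges m n" and mid: "mid (\<tau> x) = x" if "x \<in> midpoints m n" for x
    using that unfolding consistent_configuration_def by blast+
  have sub: "?\<sigma> \<subseteq> edges m n" using in_edges by blast
  have nc: "noncrossing ?\<sigma>"
    unfolding noncrossing_def
  proof (rule pairwiseI)
    fix e f assume "e \<in> ?\<sigma>" "f \<in> ?\<sigma>" and ne: "e \<noteq> f"
    then obtain x y where xy: "x \<in> midpoints m n" "e = \<tau> x" "y \<in> midpoints m n" "f = \<tau> y" by blast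
    show "\<not> crosses e f"
      using crossing_minimal_configurations[OF con \<tau>[OF xy(1)] \<tau>[OF xy(3)]] xy ne by blast
  qed
  have "E = ?\<sigma>" if E: "E \<subseteq> edges m n" "noncrossing E" "?\<sigma> \<subseteq> E" for E
  proof -
    have "e \<in> ?\<sigma>" if e: "e \<in> E" for e
    proof -
      have e_in: "e \<in> edges m n" using e E(1) by blast
      then have x: "mid e \<in> midpoints m n" by (rule mid_in_midpoints)
      then have "\<tau> (mid e) \<in> E" using E(3) by blast
      then have "\<not> crosses e (\<tau> (mid e))" using noncrossingD[OF E(2) e] by blast
      then have "e = \<tau> (mid e)"
        using crosses_if_same_mid[OF e_in in_edges[OF x]] mid[OF x] by auto
      then show ?thesis using x by blast
    qed
    then show ?thesis using E(3) by blast
  qed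
  then have tri: "triangulation m n ?\<sigma>" using sub nc unfolding triangulation_def by blast
  have at: "edge_at ?\<sigma> x = \<tau> x" if "x \<in> midpoints m n" for x
    using edge_at_mid[OF tri, of "\<tau> x"] mid[OF that] that by simp
  have "edge_at ?\<sigma> y = \<eta> y" if y: "y \<in> \<Delta>" for y
  proof -
    have ym: "y \<in> midpoints m n" and \<eta>: "\<eta> y \<in> edges m n" "mid (\<eta> y) = y"
      using con y unfolding constraints_def by blast+
    have "\<not> crosses (\<tau> y) (\<eta> y)"
      using cons[OF ym] y unfolding consistent_configuration_def by blast
    then have "\<tau> y = \<eta> y"
      using crosses_if_same_mid[OF in_edges[OF ym] \<eta>(1)] mid[OF ym] \<eta>(2) by auto
    then show ?thesis using at[OF ym] by simp
  qed
  then show "?\<sigma> \<in> \<Omega> m n \<eta> \<Delta>" using tri unfolding \<Omega>_def by blast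
  show "edge_at ?\<sigma> x = \<tau> x" if "x \<in> midpoints m n" using at[OF that] .
qed

lemma minimal_configuration_iff_len:
  assumes "minimal_configuration m n \<eta> \<Delta> x e"
  shows "minimal_configuration m n \<eta> \<Delta> x f \<longleftrightarrow>
    consistent_configuration m n \<eta> \<Delta> x f \<and> len f \<le> len e"
  using assms unfolding minimal_configuration_def is_arg_min_def by force

text \<open>Each edge of a triangulation in \<open>\<Omega> m n \<eta> \<Delta>\<close> is
  consistent, so it is at least as long as the minimal configuration at its midpoint. The minimal
  configurations form such a triangulation themselves, so the minimum of the total length is the
  sum of the individual minima, attained only termwise.\<close>

lemma ground_state_iff:
  assumes con: "constraints m n \<eta> \<Delta>"
  shows "ground_state m n \<eta> \<Delta> \<sigma> \<longleftrightarrow> \<sigma> \<in> \<Omega> m n \<eta> \<Delta> \<and>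
    (\<forall>x \<in> midpoints m n. minimal_configuration m n \<eta> \<Delta> x (edge_at \<sigma> x))"
proof -
  obtain \<tau> where \<tau>: "\<And>x. x \<in> midpoints m n \<Longrightarrow> minimal_configuration m n \<eta> \<Delta> x (\<tau> x)"
    using exists_minimal_configuration[OF con] by metis
  let ?\<rho> = "\<tau> ` midpoints m n"
  note \<rho> = minimal_configurations_triangulate[OF con \<tau>]
  have le: "len (\<tau> x) \<le> len (edge_at \<sigma> x)" if "\<sigma> \<in> \<Omega> m n \<eta> \<Delta>" "x \<in> midpoints m n" for \<sigma> x
    using \<tau>[OF that(2)] edge_at_consistent[OF con that]
    unfolding minimal_configuration_def is_arg_min_def by force
  have len_\<rho>: "total_len m n ?\<rho> = (\<Sum>x \<in> midpoints m n. len (\<tau> x))"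
    unfolding total_len_def using \<rho>(2) by (intro sum.cong) simp_all
  have total: "total_len m n ?\<rho> \<le> total_len m n \<sigma>" if "\<sigma> \<in> \<Omega> m n \<eta> \<Delta>" for \<sigma>
    unfolding len_\<rho> unfolding total_len_def by (intro sum_mono le that)
  show ?thesis
  proof
    assume gs: "ground_state m n \<eta> \<Delta> \<sigma>"
    then have \<sigma>: "\<sigma> \<in> \<Omega> m n \<eta> \<Delta>" and opt: "\<not> total_len m n ?\<rho> < total_len m n \<sigma>"
      using \<rho>(1) unfolding ground_state_def is_arg_min_def by blast+
    have "minimal_configuration m n \<eta> \<Delta> x (edge_at \<sigma> x)" if x: "x \<in> midpoints m n" for x
    proof -
      have "len (edge_at \<sigma> x) \<le> len (\<tau> x)"
      proof (rule ccontr)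
        assume "\<not> len (edge_at \<sigma> x) \<le> len (\<tau> x)"
        then have "(\<Sum>x \<in> midpoints m n. len (\<tau> x)) < (\<Sum>x \<in> midpoints m n. len (edge_at \<sigma> x))"
          using le[OF \<sigma>] x
          by (intro sum_strict_mono_ex1[OF finite_midpoints] ballI bexI[OF _ x]) simp_all
        then show False using opt unfolding len_\<rho> by (simp add: total_len_def)
      qed
      then show ?thesis
        using minimal_configuration_iff_len[OF \<tau>[OF x]] edge_at_consistent[OF con \<sigma> x] by blast
    qed
    then show "\<sigma> \<in> \<Omega> m n \<eta> \<Delta> \<and>
        (\<forall>x \<in> midpoints m n. minimal_configuration m n \<eta> \<Delta> x (edge_at \<sigma> x))"
      using \<sigma> by blast
  next
    assume "\<sigma> \<in> \<Omega> m n \<eta> \<Delta> \<and>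
      (\<forall>x \<in> midpoints m n. minimal_configuration m n \<eta> \<Delta> x (edge_at \<sigma> x))"
    then have \<sigma>: "\<sigma> \<in> \<Omega> m n \<eta> \<Delta>"
      and min: "\<And>x. x \<in> midpoints m n \<Longrightarrow> minimal_configuration m n \<eta> \<Delta> x (edge_at \<sigma> x)"
      by blast+
    have "total_len m n \<sigma> \<le> total_len m n ?\<rho>"
      unfolding len_\<rho> unfolding total_len_def
    proof (rule sum_mono)
      fix x assume "x \<in> midpoints m n"
      then show "len (edge_at \<sigma> x) \<le> len (\<tau> x)"
        using minimal_configuration_iff_len[OF \<tau>] min by blast
    qed
    then have "\<not> total_len m n \<rho>' < total_len m n \<sigma>" if "\<rho>' \<in> \<Omega> m n \<eta> \<Delta>" for \<rho>'
      using total[OF that] by linarith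
    then show "ground_state m n \<eta> \<Delta> \<sigma>"
      using \<sigma> unfolding ground_state_def is_arg_min_def by blast
  qed
qed

theorem lemma3p4:
  fixes m n :: nat and \<eta> :: "point \<Rightarrow> edge" and \<Delta> :: "point set"
  assumes "m \<ge> 1" and "n \<ge> 1" and "constraints m n \<eta> \<Delta>"
  shows "(\<exists>\<sigma>. ground_state m n \<eta> \<Delta> \<sigma>) \<and>
    (\<forall>\<sigma> \<sigma>'. ground_state m n \<eta> \<Delta> \<sigma> \<longrightarrow> ground_state m n \<eta> \<Delta> \<sigma>' \<longrightarrow>
       (\<forall>x \<in> midpoints m n. edge_at \<sigma> x \<noteq> edge_at \<sigma>' x \<longrightarrow>
          unit_diagonal (edge_at \<sigma> x) \<and> unit_diagonal (edge_at \<sigma>' x))) \<and>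
    {\<sigma>. ground_state m n \<eta> \<Delta> \<sigma>} =
      {\<tau> ` midpoints m n | \<tau>. \<forall>x \<in> midpoints m n. minimal_configuration m n \<eta> \<Delta> x (\<tau> x)}"
proof -
  note con = assms(3)
  note ground = ground_state_iff[OF con]
  have from_min: "ground_state m n \<eta> \<Delta> (\<tau> ` midpoints m n)"
    if "\<forall>x \<in> midpoints m n. minimal_configuration m n \<eta> \<Delta> x (\<tau> x)" for \<tau>
    unfolding ground using minimal_configurations_triangulate[OF con, of \<tau>] that by simp
  have to_min: "\<exists>\<tau>. \<sigma> = \<tau> ` midpoints m n \<and>
      (\<forall>x \<in> midpoints m n. minimal_configuration m n \<eta> \<Delta> x (\<tau> x))"
    if "ground_state m n \<eta> \<Delta> \<sigma>" for \<sigma>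
    using that triangulation_eq_edge_at_image[of m n \<sigma>] unfolding ground \<Omega>_def by blast
  have "\<exists>\<sigma>. ground_state m n \<eta> \<Delta> \<sigma>"
    using from_min exists_minimal_configuration[OF con] by metis
  moreover have "unit_diagonal (edge_at \<sigma> x) \<and> unit_diagonal (edge_at \<sigma>' x)"
    if gs: "ground_state m n \<eta> \<Delta> \<sigma>" "ground_state m n \<eta> \<Delta> \<sigma>'"
      and x: "x \<in> midpoints m n" and ne: "edge_at \<sigma> x \<noteq> edge_at \<sigma>' x" for \<sigma> \<sigma>' x
  proof -
    have min: "minimal_configuration m n \<eta> \<Delta> x (edge_at \<sigma> x)"
      "minimal_configuration m n \<eta> \<Delta> x (edge_at \<sigma>' x)"
      using gs x unfolding ground by blast+
    then have "crosses (edge_at \<sigma> x) (edge_at \<sigma>' x)"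
      using crosses_if_same_mid[of "edge_at \<sigma> x" m n "edge_at \<sigma>' x"] ne
      unfolding minimal_configuration_def is_arg_min_def consistent_configuration_def by simp
    then show ?thesis using crossing_minimal_configurations[OF con min] by blast
  qed
  moreover have "{\<sigma>. ground_state m n \<eta> \<Delta> \<sigma>} =
      {\<tau> ` midpoints m n | \<tau>. \<forall>x \<in> midpoints m n. minimal_configuration m n \<eta> \<Delta> x (\<tau> x)}"
    using from_min to_min by blast
  ultimately show ?thesis by blast
qed

end
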